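(* Let $q$ be a complex number with $|q|<1$. Then the following three identities hold: \begin{align*} \sum_{i,j,k\ge 0}\frac{q^{\frac{1}{2}i^2+4j^2+2k^2+ij+4jk+\frac{1}{2}i}}{(q;q)_i(q;q)_j(q^2;q^2)_k} &=\frac{(q^6,q^8,q^{14};q^{14})_\infty}{(q;q)_\infty},\\ \sum_{i,j,k\ge 0}\frac{q^{\frac{1}{2}i^2+4j^2+2k^2+ij+4jk+\frac{1}{2}i+2j}}{(q;q)_i(q;q)_j(q^2;q^2)_k} &=\frac{(q^4,q^{10},q^{14};q^{14})_\infty}{(q;q)_\infty},\\ \sum_{i,j,k\ge 0}\frac{q^{\frac{1}{2}i^2+4j^2+2k^2+ij+4jk+\frac{1}{2}i+4j+2k}}{(q;q)_i(q;q)_j(q^2;q^2)_k} &=\frac{(q^2,q^{12},q^{14};q^{14})_\infty}{(q;q)_\infty}. \end{align*}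
   Context: For $|q|<1$: $(a;q)_\infty=\prod_{m=0}^\infty(1-aq^m)$, $(a;q)_n=(a;q)_\infty/(aq^n;q)_\infty=\prod_{m=0}^{n-1}(1-aq^m)$ for integers $n\ge0$, and $(a_1,\dots,a_r;q)_\infty=(a_1;q)_\infty\cdots(a_r;q)_\infty$; the same notation is used with the base $q$ replaced by a power of $q$. All exponents of $q$ in the sums are integers. *)

theory Defs
  imports "HOL-Analysis.Analysis"
begin

definition qpoch :: "complex \<Rightarrow> complex \<Rightarrow> nat \<Rightarrow> complex" where
  "qpoch a q n = (\<Prod>m<n. 1 - a * q ^ m)"

definition qpoch_inf :: "complex \<Rightarrow> complex \<Rightarrow> complex" where
  "qpoch_inf a q = prodinf (\<lambda>m. 1 - a * q ^ m)"

definition qpoch_inf_list :: "complex list \<Rightarrow> complex \<Rightarrow> complex" where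
  "qpoch_inf_list as q = (\<Prod>a\<leftarrow>as. qpoch_inf a q)"

lemma convergent_prod_qpoch_inf:
  fixes a q :: complex
  assumes "norm q < 1"
  shows "convergent_prod (\<lambda>m. 1 - a * q ^ m)"
proof -
  have "summable (\<lambda>m. norm a * norm q ^ m)"
    using assms by (intro summable_mult summable_geometric) simp
  then have "abs_convergent_prod (\<lambda>m. 1 - a * q ^ m)"
    by (subst abs_convergent_prod_conv_summable) (simp add: norm_mult norm_power)
  then show ?thesis
    by (rule abs_convergent_prod_imp_convergent_prod)
qed

(* The quotient form (a;q)_n = (a;q)_inf / (a q^n;q)_inf, where it makes sense. *)
lemma qpoch_eq_quotient:
  assumes "norm q < 1" and "qpoch_inf (a * q ^ n) q \<noteq> 0"
  shows "qpoch a q n = qpoch_inf a q / qpoch_inf (a * q ^ n) q"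
proof -
  have "(\<lambda>m. \<Prod>i\<le>m. 1 - a * q ^ i) \<longlonglongrightarrow> qpoch_inf a q"
    unfolding qpoch_inf_def by (rule convergent_prod_LIMSEQ[OF convergent_prod_qpoch_inf[OF assms(1)]])
  then have 1: "(\<lambda>m. \<Prod>i\<le>m + n. 1 - a * q ^ i) \<longlonglongrightarrow> qpoch_inf a q"
    by (rule LIMSEQ_ignore_initial_segment)
  have "(\<lambda>m. \<Prod>i\<le>m. 1 - a * q ^ n * q ^ i) \<longlonglongrightarrow> qpoch_inf (a * q ^ n) q"
    unfolding qpoch_inf_def by (rule convergent_prod_LIMSEQ[OF convergent_prod_qpoch_inf[OF assms(1)]])
  then have 2: "(\<lambda>m. qpoch a q n * (\<Prod>i\<le>m. 1 - a * q ^ n * q ^ i))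
      \<longlonglongrightarrow> qpoch a q n * qpoch_inf (a * q ^ n) q"
    by (rule tendsto_mult_left)
  have "(\<Prod>i<k + n. 1 - a * q ^ i) = qpoch a q n * (\<Prod>i<k. 1 - a * q ^ n * q ^ i)" for k
  proof (induction k)
    case 0
    show ?case by (simp add: qpoch_def)
  next
    case (Suc k)
    have "a * q ^ (k + n) = a * q ^ n * q ^ k"
      by (simp add: power_add)
    then show ?case
      by (simp only: add_Suc prod.lessThan_Suc Suc.IH mult.assoc)
  qed
  from this[of "Suc m" for m]
  have "(\<Prod>i\<le>m + n. 1 - a * q ^ i) = qpoch a q n * (\<Prod>i\<le>m. 1 - a * q ^ n * q ^ i)" for m
    by (simp only: add_Suc lessThan_Suc_atMost)
  with 1 2 have "qpoch_inf a q = qpoch a q n * qpoch_inf (a * q ^ n) q"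
    using LIMSEQ_unique by simp
  with assms(2) show ?thesis by simp
qed

end

theory Submission
  imports Defs
begin

text \<open>
  In each of the three sums the index \<open>i\<close> can be summed first: Euler's identity
  \<open>\<Sum>_i q^(i(i-1)/2) z^i / (q;q)_i = (-z;q)_\<infinity>\<close> with \<open>z = q^(j+1)\<close> evaluates it to \<open>(-q;q)_\<infinity> / (-q;q)_j\<close>.
  Since \<open>(q;q)_j (-q;q)_j = (q^2;q^2)_j\<close>, there remains \<open>(-q;q)_\<infinity>\<close> times a double sum in the base
  \<open>q^2\<close>, which is the Andrews-Gordon sum modulo 7 with \<open>N_1 = j + k\<close> and \<open>N_2 = j\<close>. Its value is a product
  over \<open>(q^2;q^2)_\<infinity>\<close>, and \<open>(-q;q)_\<infinity> / (q^2;q^2)_\<infinity> = 1 / (q;q)_\<infinity>\<close>.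

  The Andrews-Gordon identities follow from q-difference equations. Andrews' method introduces a variable \<open>x\<close>
  and shows that the double sums and certain alternating series satisfy the same equations relating \<open>x\<close> to
  \<open>xq\<close>. Only the values \<open>x = q^n\<close> matter, so the equations become the linear recursion of
  \<open>linear_recursion_trivial\<close>, whose solutions are determined by their limits for \<open>n \<rightarrow> \<infinity>\<close>. The double sums
  obey it by shifting a summation index (\<open>ag_sum_shift_j\<close>, \<open>ag_sum_shift_k\<close>), the alternating series by a
  telescoping sum (\<open>ag_alt_recursion\<close>).

  At \<open>n = 0\<close> the alternating series is the bilateral theta series of the Jacobi triple product
  (\<open>jacobi_triple_product\<close>), which yields the product side. Both this product formula and Euler's identity
  (\<open>euler_sum\<close>) are limits, by Tannery's theorem, of the finite q-binomial theorem (\<open>qbinomial_theorem\<close>).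
\<close>

section \<open>Shifted factorials\<close>

lemma qpoch_0 [simp]: "qpoch a q 0 = 1"
  by (simp add: qpoch_def)

lemma qpoch_Suc: "qpoch a q (Suc n) = qpoch a q n * (1 - a * q ^ n)"
  by (simp add: qpoch_def)

lemma qpoch_self_Suc: "qpoch q q (Suc n) = qpoch q q n * (1 - q ^ Suc n)"
  by (simp add: qpoch_def)

lemma qpoch_tendsto:
  assumes "norm q < 1"
  shows "(\<lambda>n. qpoch a q n) \<longlonglongrightarrow> qpoch_inf a q"
proof -
  have "(\<lambda>n. qpoch a q (Suc n)) \<longlonglongrightarrow> qpoch_inf a q"
    unfolding qpoch_def qpoch_inf_def lessThan_Suc_atMost
    by (rule convergent_prod_LIMSEQ[OF convergent_prod_qpoch_inf[OF assms]])
  then show ?thesis by (rule LIMSEQ_imp_Suc)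
qed

text \<open>
  This is the reason why none of the quotients below has a vanishing denominator.
\<close>

lemma qpoch_factor_nonzero:
  fixes a q :: complex
  assumes "norm q < 1" "norm a < 1"
  shows "1 - a * q ^ m \<noteq> 0"
proof
  assume "1 - a * q ^ m = 0"
  then have "norm a * norm q ^ m = 1"
    by (metis eq_iff_diff_eq_0 norm_mult norm_one norm_power)
  moreover have "norm a * norm q ^ m \<le> norm a * 1"
    using assms by (intro mult_left_mono power_le_one) auto
  ultimately show False using assms by simp
qed

lemma qpoch_nonzero:
  assumes "norm q < 1" "norm a < 1"
  shows "qpoch a q n \<noteq> 0"
  using qpoch_factor_nonzero[OF assms] by (simp add: qpoch_def)

lemma qpoch_inf_nonzero:
  assumes "norm q < 1" "norm a < 1"
  shows "qpoch_inf a q \<noteq> 0"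
  unfolding qpoch_inf_def
  using qpoch_factor_nonzero[OF assms] by (intro prodinf_nonzero convergent_prod_qpoch_inf assms)

lemma one_minus_power_Suc_nonzero: "norm q < 1 \<Longrightarrow> 1 - q ^ Suc n \<noteq> (0 :: complex)"
  using qpoch_factor_nonzero[of q q n] by simp

text \<open>
  Both \<open>(q;q)_n\<close> and its reciprocal converge, the limit being nonzero, so one constant
  bounds both of them. Every domination argument below uses this constant.
\<close>

lemma qpoch_self_bounds:
  assumes "norm q < 1"
  obtains C where "C \<ge> 1" "\<And>n. norm (qpoch q q n) \<le> C" "\<And>n. norm (inverse (qpoch q q n)) \<le> C"
proof -
  note lim = qpoch_tendsto[OF assms, of q]
  obtain A where A: "\<And>n. norm (qpoch q q n) \<le> A"
    using convergent_imp_Bseq[OF convergentI[OF lim]] by (auto simp: Bseq_def)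
  obtain B where B: "\<And>n. norm (inverse (qpoch q q n)) \<le> B"
    using convergent_imp_Bseq[OF convergentI[OF tendsto_inverse[OF lim qpoch_inf_nonzero[OF assms assms]]]]
    by (auto simp: Bseq_def)
  show ?thesis
    by (rule that[of "max 1 (max A B)"]) (use A B in \<open>auto simp: le_max_iff_disj\<close>)
qed

section \<open>The finite q-binomial theorem\<close>

text \<open>
  The Gaussian binomial coefficient, extended by zero beyond \<open>N\<close> so that Pascal's rule covers
  \<open>k = N\<close> and finite sums can be read as infinite series.
\<close>

definition qbinom :: "complex \<Rightarrow> nat \<Rightarrow> nat \<Rightarrow> complex" where
  "qbinom q N k = (if k \<le> N then qpoch q q N / (qpoch q q k * qpoch q q (N - k)) else 0)"

lemma qbinom_0 [simp]: "norm q < 1 \<Longrightarrow> qbinom q N 0 = 1"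
  by (simp add: qbinom_def qpoch_nonzero)

text \<open>
  Multiply the identity \<open>1 - q^(N+1) = (1 - q^(N-k)) + q^(N-k) (1 - q^(k+1))\<close> by the common factor
  \<open>(q;q)_N / ((q;q)_(k+1) (q;q)_(N-k))\<close>.
\<close>

lemma qbinom_pascal:
  assumes q: "norm q < 1" and "k \<le> N"
  shows "qbinom q (Suc N) (Suc k) = qbinom q N (Suc k) + q ^ (N - k) * qbinom q N k"
proof (cases "k = N")
  case True
  then show ?thesis by (simp add: qbinom_def qpoch_nonzero[OF q q])
next
  case False
  define d where "d = N - Suc k"
  have N: "N = Suc k + d" and Nk: "N - k = Suc d" using False assms by (auto simp: d_def)
  have "1 - q ^ Suc N = (1 - q ^ Suc d) + q ^ Suc d * (1 - q ^ Suc k)"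
    by (simp add: N power_add algebra_simps)
  moreover have "1 - q ^ Suc d \<noteq> 0" "1 - q ^ Suc k \<noteq> 0"
    using one_minus_power_Suc_nonzero[OF q] by blast+
  ultimately show ?thesis
    using qpoch_nonzero[OF q q, of k] qpoch_nonzero[OF q q, of d]
    unfolding qbinom_def Nk diff_Suc_Suc using N
    by (simp add: qpoch_self_Suc divide_simps del: power_Suc) (simp add: algebra_simps del: power_Suc)
qed

lemma Suc_choose_two: "Suc n choose 2 = n + (n choose 2)"
  by (simp add: numeral_2_eq_2)

text \<open>
  The homogeneous form, with \<open>y\<close> beside \<open>z\<close>, allows \<open>y\<close> to be a power of \<open>q\<close> later on, which avoids
  negative powers in the proof of the triple product. The induction on \<open>N\<close> is Pascal's rule term by term.
\<close>

lemma qbinomial_theorem: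
  fixes y z :: complex
  assumes q: "norm q < 1"
  shows "(\<Prod>m<N. y + z * q ^ m) = (\<Sum>k\<le>N. qbinom q N k * q ^ (k choose 2) * z ^ k * y ^ (N - k))"
proof (induction N)
  case 0
  show ?case using q by (simp add: numeral_2_eq_2)
next
  case (Suc N)
  define t where "t = (\<lambda>N k. qbinom q N k * q ^ (k choose 2) * z ^ k * y ^ (N - k))"
  have t0: "t (Suc N) 0 = y * t N 0" using q by (simp add: t_def)
  have tS: "t (Suc N) (Suc k) = y * t N (Suc k) + z * q ^ N * t N k" if "k \<le> N" for k
  proof -
    have e: "(Suc k choose 2) + (N - k) = N + (k choose 2)"
      using that by (simp add: Suc_choose_two)
    have "q ^ (Suc k choose 2) * q ^ (N - k) = q ^ N * q ^ (k choose 2)"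
      by (simp only: power_add[symmetric] e)
    moreover have "qbinom q N (Suc k) * y ^ (N - k) = qbinom q N (Suc k) * (y * y ^ (N - Suc k))"
    proof (cases "k = N")
      case False
      then have "N - k = Suc (N - Suc k)" using that by simp
      then show ?thesis by simp
    qed (simp add: qbinom_def)
    moreover have "(A + B * C) * D * (z * Z) * Y = y * (A * D * (z * Z) * Y') + z * Q * (C * E * Z * Y)"
      if "D * B = Q * E" and "A * Y = A * (y * Y')" for A B C D E Q Y Y' Z :: complex
      using that by algebra
    ultimately show ?thesis
      unfolding t_def qbinom_pascal[OF q that] diff_Suc_Suc power_Suc by blast
  qed
  have "t N (Suc N) = 0" by (simp add: t_def qbinom_def)
  then have A: "(\<Sum>k\<le>Suc N. t N k) = (\<Sum>k\<le>N. t N k)" by simp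
  have "(\<Sum>k\<le>Suc N. t (Suc N) k) = t (Suc N) 0 + (\<Sum>k\<le>N. t (Suc N) (Suc k))"
    by (rule sum.atMost_Suc_shift)
  also have "\<dots> = y * (t N 0 + (\<Sum>k\<le>N. t N (Suc k))) + z * q ^ N * (\<Sum>k\<le>N. t N k)"
    by (simp add: t0 tS sum.distrib sum_distrib_left algebra_simps)
  also have "t N 0 + (\<Sum>k\<le>N. t N (Suc k)) = (\<Sum>k\<le>N. t N k)"
    by (simp only: sum.atMost_Suc_shift[symmetric] A)
  finally show ?case
    using Suc.IH by (simp add: t_def algebra_simps)
qed

section \<open>Euler's series\<close>

lemma qbinom_tendsto:
  assumes q: "norm q < 1"
  shows "(\<lambda>N. qbinom q N k) \<longlonglongrightarrow> inverse (qpoch q q k)"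
proof -
  note lim = qpoch_tendsto[OF q, of q]
  have "(\<lambda>n. qpoch q q (n + k) / (qpoch q q k * qpoch q q n))
      \<longlonglongrightarrow> qpoch_inf q q / (qpoch q q k * qpoch_inf q q)"
    by (intro tendsto_intros lim LIMSEQ_ignore_initial_segment[OF lim])
      (use qpoch_nonzero[OF q q] qpoch_inf_nonzero[OF q q] in auto)
  then have "(\<lambda>n. qbinom q (n + k) k) \<longlonglongrightarrow> inverse (qpoch q q k)"
    using qpoch_inf_nonzero[OF q q] by (simp add: qbinom_def field_simps)
  then show ?thesis by (rule LIMSEQ_offset)
qed

lemma central_qbinom_tendsto:
  assumes q: "norm q < 1"
  shows "(\<lambda>n. qbinom q (2 * n) (n + j)) \<longlonglongrightarrow> inverse (qpoch_inf q q)"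
proof -
  note lim = qpoch_tendsto[OF q, of q]
  have lim2: "filterlim (\<lambda>n. 2 * (n + j)) sequentially sequentially" for j :: nat
    by (rule filterlim_subseq) (auto simp: strict_mono_def)
  have "(\<lambda>n. qpoch q q (2 * (n + j)) / (qpoch q q (n + 2 * j) * qpoch q q n))
      \<longlonglongrightarrow> qpoch_inf q q / (qpoch_inf q q * qpoch_inf q q)"
    by (intro tendsto_intros lim LIMSEQ_ignore_initial_segment[OF lim] filterlim_compose[OF lim lim2])
      (use qpoch_inf_nonzero[OF q q] in auto)
  moreover have "qbinom q (2 * (n + j)) (n + j + j)
      = qpoch q q (2 * (n + j)) / (qpoch q q (n + 2 * j) * qpoch q q n)" for n
    by (simp add: qbinom_def mult_2 add.assoc)
  ultimately have "(\<lambda>n. qbinom q (2 * (n + j)) (n + j + j)) \<longlonglongrightarrow> inverse (qpoch_inf q q)"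
    using qpoch_inf_nonzero[OF q q] by (simp add: field_simps)
  then show ?thesis by (rule LIMSEQ_offset[where k = j and f = "\<lambda>n. qbinom q (2 * n) (n + j)"])
qed

lemma qbinom_bounded:
  assumes q: "norm q < 1"
  obtains C where "C \<ge> 0" "\<And>N k. norm (qbinom q N k) \<le> C"
proof -
  obtain A where A: "A \<ge> 1" "\<And>n. norm (qpoch q q n) \<le> A" "\<And>n. norm (inverse (qpoch q q n)) \<le> A"
    using qpoch_self_bounds[OF q] by blast
  have "norm (qbinom q N k) \<le> A * (A * A)" for N k
  proof (cases "k \<le> N")
    case True
    then have "norm (qbinom q N k) = norm (qpoch q q N)
        * (norm (inverse (qpoch q q k)) * norm (inverse (qpoch q q (N - k))))"
      by (simp add: qbinom_def norm_mult norm_divide norm_inverse field_simps)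
    also have "\<dots> \<le> A * (A * A)" using A by (intro mult_mono) auto
    finally show ?thesis .
  qed (use A in \<open>simp add: qbinom_def\<close>)
  then show ?thesis using that[of "A * (A * A)"] A by simp
qed

text \<open>
  Tannery's theorem in the form used to let \<open>N\<close> grow in a finite identity: the termwise limits sum
  to the limit of the sums.
\<close>

lemma sums_by_tannery:
  fixes a :: "nat \<Rightarrow> nat \<Rightarrow> complex"
  assumes lim: "\<And>k. (\<lambda>n. a k n) \<longlonglongrightarrow> b k"
    and bound: "\<And>k n. norm (a k n) \<le> M k" and "summable M"
    and sum: "(\<lambda>n. \<Sum>k. a k n) \<longlonglongrightarrow> L"
  shows "summable (\<lambda>k. norm (b k))" and "b sums L"
proof -
  have T: "summable (\<lambda>k. norm (b k)) \<and> ((\<lambda>n. \<Sum>k. a k n) \<longlonglongrightarrow> suminf b)"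
    using tannerys_theorem[of a b sequentially M, OF lim _ \<open>summable M\<close>] bound
    by (simp add: split_def)
  then show "summable (\<lambda>k. norm (b k))" by blast
  from T sum have "suminf b = L" using LIMSEQ_unique by blast
  with T show "b sums L" using summable_norm_cancel summable_sums by blast
qed

text \<open>
  The limit \<open>N \<rightarrow> \<infinity>\<close> of the q-binomial theorem with \<open>y = 1\<close>. The geometric majorant is where
  \<open>norm z < 1\<close> enters.
\<close>

lemma euler_sum:
  fixes z :: complex
  assumes q: "norm q < 1" and z: "norm z < 1"
  shows "((\<lambda>k. q ^ (k choose 2) * z ^ k / qpoch q q k) has_sum qpoch_inf (- z) q) UNIV"
proof -
  obtain C where C: "C \<ge> 0" "\<And>N k. norm (qbinom q N k) \<le> C"
    using qbinom_bounded[OF q] by blast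
  define a where "a = (\<lambda>k N. qbinom q N k * (q ^ (k choose 2) * z ^ k))"
  have lim: "(\<lambda>N. a k N) \<longlonglongrightarrow> q ^ (k choose 2) * z ^ k / qpoch q q k" for k
    using tendsto_mult_right[OF qbinom_tendsto[OF q, of k], of "q ^ (k choose 2) * z ^ k"]
    by (simp add: a_def field_simps)
  have bound: "norm (a k N) \<le> C * norm z ^ k" for k N
  proof -
    have "norm (a k N) = norm (qbinom q N k) * (norm q ^ (k choose 2) * norm z ^ k)"
      by (simp add: a_def norm_mult norm_power)
    also have "\<dots> \<le> C * (1 * norm z ^ k)"
      using C q by (intro mult_mono power_le_one) auto
    finally show ?thesis by simp
  qed
  have "(\<Sum>k. a k N) = qpoch (- z) q N" for N
  proof -
    have "(\<Sum>k. a k N) = (\<Sum>k\<le>N. a k N)"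
      by (rule suminf_finite) (auto simp: a_def qbinom_def)
    also have "\<dots> = qpoch (- z) q N"
      using qbinomial_theorem[OF q, of 1 z N] by (simp add: a_def qpoch_def mult.assoc)
    finally show ?thesis .
  qed
  with qpoch_tendsto[OF q] have sum: "(\<lambda>N. \<Sum>k. a k N) \<longlonglongrightarrow> qpoch_inf (- z) q" by simp
  have "summable (\<lambda>k. C * norm z ^ k)" using z by (intro summable_mult summable_geometric) simp
  from sums_by_tannery[OF lim bound this sum] show ?thesis
    by (rule norm_summable_imp_has_sum)
qed

section \<open>The Jacobi triple product\<close>

lemma choose_two_add: "(m + n) choose 2 = (m choose 2) + (n choose 2) + m * n"
  by (induction n) (simp_all add: Suc_choose_two binomial_eq_0)

lemma choose_two_double: "2 * (n choose 2) + n = n * n"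
  by (induction n) (simp_all add: Suc_choose_two binomial_eq_0)

lemma prod_lessThan_add:
  fixes f :: "nat \<Rightarrow> complex"
  shows "prod f {..<n + m} = prod f {..<n} * (\<Prod>j<m. f (n + j))"
  by (induction m) (simp_all add: mult.assoc)

lemma prod_powers: "(\<Prod>m<n. p ^ m) = (p :: complex) ^ (n choose 2)"
  by (induction n) (simp_all add: Suc_choose_two binomial_eq_0 power_add)

lemma sum_lessThan_add:
  fixes f :: "nat \<Rightarrow> complex"
  shows "sum f {..<n + m} = sum f {..<n} + (\<Sum>j<m. f (n + j))"
  by (induction m) (simp_all add: add.assoc)

text \<open>
  The Gaussian coefficient centred at \<open>n\<close> is symmetric, so the indices \<open>j\<close> and \<open>- j - 1\<close> of the
  bilateral sum in the finite triple product share one term here. All exponents then stay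
  natural numbers.
\<close>

definition triple_term :: "complex \<Rightarrow> complex \<Rightarrow> nat \<Rightarrow> nat \<Rightarrow> complex" where
  "triple_term a b n j = (- 1) ^ j *
     (qbinom (a * b) (2 * n) (n + j) * ((a * b) ^ (j choose 2) * a ^ j)
      - qbinom (a * b) (2 * n) (n + Suc j) * ((a * b) ^ (Suc j choose 2) * b ^ Suc j))"

text \<open>
  Put \<open>y = p^n\<close>, \<open>z = - a\<close> and \<open>N = 2n\<close> in the q-binomial theorem, where \<open>p = ab\<close>. On the product
  side the factors with \<open>m \<ge> n\<close> give \<open>(a;p)_n\<close>; those with \<open>m < n\<close> give \<open>(b;p)_n\<close> in reverse order, because
  \<open>p^n - a p^m = - a p^m (1 - b p^(n-1-m))\<close>. On both sides the same factor \<open>K\<close> splits off, and it is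
  cancelled; this is why \<open>ab \<noteq> 0\<close>.
\<close>

lemma finite_triple_product:
  fixes a b :: complex
  assumes p: "norm (a * b) < 1" and nz: "a * b \<noteq> 0"
  shows "(\<Sum>j\<le>n. triple_term a b n j) = qpoch a (a * b) n * qpoch b (a * b) n"
proof -
  define p where "p = a * b"
  have q: "norm p < 1" using assms by (simp add: p_def)
  define K where "K = (- a) ^ n * p ^ ((n choose 2) + n * n)"
  have K: "K \<noteq> 0" using nz by (auto simp: K_def p_def)
  define f where "f = (\<lambda>k. qbinom p (2 * n) k * p ^ (k choose 2) * (- a) ^ k * (p ^ n) ^ (2 * n - k))"
  define u where "u = (\<lambda>j. (- 1) ^ j * (qbinom p (2 * n) (n + j) * (p ^ (j choose 2) * a ^ j)))"
  define v where "v = (\<lambda>j. (- 1) ^ j * (qbinom p (2 * n) (n + j) * (p ^ (j choose 2) * b ^ j)))"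
  (* The upper half of the sum carries the powers of a, the lower half those of b. *)
  have up: "f (n + j) = K * u j" if "j \<le> n" for j
  proof -
    have "((n + j) choose 2) + n * (2 * n - (n + j)) = (n choose 2) + n * n + (j choose 2)"
    proof -
      obtain d where "n = j + d" using le_Suc_ex[OF \<open>j \<le> n\<close>] by blast
      moreover from this have "2 * n - (n + j) = d" by simp
      ultimately show ?thesis by (simp only: choose_two_add) (simp add: algebra_simps)
    qed
    then have "p ^ ((n + j) choose 2) * (p ^ n) ^ (2 * n - (n + j)) = p ^ ((n choose 2) + n * n) * p ^ (j choose 2)"
      by (simp only: power_add[symmetric] power_mult[symmetric])
    moreover have "(- a) ^ (n + j) = (- a) ^ n * ((- 1) ^ j * a ^ j)"
      by (simp add: power_add power_minus[of a j])
    moreover have "B * T * A * Y = L * M * (s * (B * (X * x)))"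
      if "T * Y = M * X" and "A = L * (s * x)" for A B L M T X Y s x :: complex
      using that by algebra
    ultimately show ?thesis unfolding f_def K_def u_def by blast
  qed
  have down: "f (n - i) = K * v i" if "i \<le> n" for i
  proof -
    obtain d where n: "n = i + d" using le_Suc_ex[OF \<open>i \<le> n\<close>] by blast
    have "qbinom p (2 * n) d = qbinom p (2 * n) (n + i)"
    proof -
      have "2 * n - d = n + i" "2 * n - (n + i) = d" "d \<le> 2 * n" "n + i \<le> 2 * n" by (simp_all add: n)
      then show ?thesis by (simp only: qbinom_def if_True mult.commute)
    qed
    moreover have "(d choose 2) + n * (2 * n - d) = (n choose 2) + n * n + (i choose 2) + i"
    proof -
      have "2 * n - d = n + i" by (simp add: n)
      then show ?thesis
        using choose_two_double[of i] by (simp only: n choose_two_add) (simp add: algebra_simps)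
    qed
    then have "p ^ (d choose 2) * (p ^ n) ^ (2 * n - d) = p ^ ((n choose 2) + n * n) * p ^ (i choose 2) * p ^ i"
      by (simp only: power_add[symmetric] power_mult[symmetric])
    moreover have "(- a) ^ n * ((- 1) ^ i * b ^ i) = (- a) ^ d * p ^ i"
    proof -
      have "(- a) ^ n * ((- 1) ^ i * b ^ i) = (- a) ^ d * ((- a) ^ i * ((- 1) ^ i * b ^ i))"
        by (simp add: n power_add)
      also have "(- a) ^ i * ((- 1) ^ i * b ^ i) = p ^ i"
        by (simp only: power_mult_distrib[symmetric]) (simp add: p_def)
      finally show ?thesis .
    qed
    moreover have "n - i = d" by (simp add: n)
    moreover have "B * T * A * Y = L * M * (s * (B' * (X * x)))"
      if "B = B'" and TY: "T * Y = M * X * w" and Lx: "L * (s * x) = A * w"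
      for A B B' L M T X Y s x w :: complex
    proof -
      have "B * T * A * Y = B' * A * (T * Y)" by (simp add: \<open>B = B'\<close>)
      also have "\<dots> = B' * M * X * (L * (s * x))" unfolding TY Lx by simp
      finally show ?thesis by (simp add: mult.left_commute mult.assoc)
    qed
    ultimately show ?thesis unfolding f_def K_def v_def \<open>n - i = d\<close> by blast
  qed
  have "(\<Prod>m<n + n. p ^ n + (- a) * p ^ m) = K * (qpoch a p n * qpoch b p n)"
  proof -
    have "p ^ n + (- a) * p ^ m = (- a) * p ^ m * (1 - b * p ^ (n - Suc m))" if "m < n" for m
    proof -
      have "p ^ n = p * (p ^ m * p ^ (n - Suc m))"
        using that by (simp flip: power_add power_Suc)
      then show ?thesis by (simp add: p_def algebra_simps)
    qed
    then have "(\<Prod>m<n. p ^ n + (- a) * p ^ m) = (\<Prod>m<n. (- a) * p ^ m * (1 - b * p ^ (n - Suc m)))"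
      by (intro prod.cong) auto
    also have "\<dots> = (- a) ^ n * p ^ (n choose 2) * qpoch b p n"
      unfolding qpoch_def prod.nat_diff_reindex[of "\<lambda>m. 1 - b * p ^ m", symmetric]
      by (simp only: prod.distrib prod_powers prod_constant card_lessThan)
    finally have lower: "(\<Prod>m<n. p ^ n + (- a) * p ^ m) = (- a) ^ n * p ^ (n choose 2) * qpoch b p n" .
    have "(\<Prod>m<n. p ^ n + (- a) * p ^ (n + m)) = (\<Prod>m<n. p ^ n * (1 - a * p ^ m))"
      by (simp add: power_add algebra_simps)
    also have "\<dots> = p ^ (n * n) * qpoch a p n"
      unfolding qpoch_def by (simp add: prod.distrib power_mult)
    finally show ?thesis
      unfolding prod_lessThan_add lower K_def power_add by (simp add: mult.commute mult.left_commute)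
  qed
  then have "K * (qpoch a p n * qpoch b p n) = (\<Sum>k<n + Suc n. f k)"
    using qbinomial_theorem[OF q, of "p ^ n" "- a" "2 * n"]
    by (simp add: f_def mult_2 lessThan_Suc_atMost)
  also have "\<dots> = (\<Sum>j<n. f (n - Suc j)) + (\<Sum>j<Suc n. f (n + j))"
    by (simp only: sum_lessThan_add sum.nat_diff_reindex)
  also have "\<dots> = (\<Sum>j<n. K * v (Suc j)) + (\<Sum>j<Suc n. K * u j)"
    by (intro arg_cong2[where f = "(+)"] sum.cong refl up down) auto
  also have "(\<Sum>j<n. K * v (Suc j)) = (\<Sum>j<Suc n. K * v (Suc j))"
    by (simp add: v_def qbinom_def)
  also have "\<dots> + (\<Sum>j<Suc n. K * u j) = K * (\<Sum>j<Suc n. u j + v (Suc j))"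
    by (simp only: sum.distrib sum_distrib_left distrib_left add.commute)
  finally have "qpoch a p n * qpoch b p n = (\<Sum>j<Suc n. u j + v (Suc j))"
    using K by simp
  moreover have "u j + v (Suc j) = triple_term a b n j" for j
    by (simp add: u_def v_def triple_term_def p_def algebra_simps)
  ultimately show ?thesis by (simp add: p_def lessThan_Suc_atMost)
qed

lemma qpoch_inf_base_0: "qpoch_inf a 0 = 1 - a"
proof -
  have "qpoch_inf a 0 = (\<Prod>m\<in>{0}. 1 - a * 0 ^ m)"
    unfolding qpoch_inf_def by (rule prodinf_finite) auto
  then show ?thesis by simp
qed

text \<open>
  The limit \<open>n \<rightarrow> \<infinity>\<close> of the finite triple product, in Ramanujan's symmetric notation \<open>f(-a,-b)\<close> with the
  terms of index \<open>j\<close> and \<open>- j - 1\<close> combined. The central Gaussian coefficients tend to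
  \<open>1 / (p;p)_\<infinity>\<close>. When \<open>ab = 0\<close> only two terms of the series survive.
\<close>

theorem jacobi_triple_product:
  fixes a b :: complex
  assumes a: "norm a < 1" and b: "norm b < 1"
  shows "(\<lambda>j. (- 1) ^ j * ((a * b) ^ (j choose 2) * a ^ j - (a * b) ^ (Suc j choose 2) * b ^ Suc j))
    sums (qpoch_inf a (a * b) * qpoch_inf b (a * b) * qpoch_inf (a * b) (a * b))"
proof (cases "a * b = 0")
  case True
  let ?t = "\<lambda>j. (- 1) ^ j * ((0::complex) ^ (j choose 2) * a ^ j - 0 ^ (Suc j choose 2) * b ^ Suc j)"
  have "?t j = 0" if "j \<notin> {0, 1}" for j
  proof -
    have "j choose 2 > 0" "Suc j choose 2 > 0" using that by (auto simp: Suc_choose_two)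
    then show ?thesis by (simp only: zero_power mult_zero_left mult_zero_right diff_zero)
  qed
  then have "?t sums sum ?t {0, 1}" by (intro sums_finite) auto
  moreover have "sum ?t {0, 1} = (1 - a) * (1 - b)"
    using True by (simp add: numeral_2_eq_2 algebra_simps)
  ultimately show ?thesis unfolding True qpoch_inf_base_0 by simp
next
  case False
  have p: "norm (a * b) < 1"
    using a b mult_strict_mono[of "norm a" 1 "norm b" 1] by (simp add: norm_mult)
  obtain C where C: "C \<ge> 0" "\<And>N k. norm (qbinom (a * b) N k) \<le> C"
    using qbinom_bounded[OF p] by blast
  define P where "P = qpoch_inf (a * b) (a * b)"
  have P: "P \<noteq> 0" unfolding P_def by (rule qpoch_inf_nonzero[OF p p])
  let ?b = "\<lambda>j. (- 1) ^ j * ((a * b) ^ (j choose 2) * a ^ j - (a * b) ^ (Suc j choose 2) * b ^ Suc j)"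
  have lim: "(\<lambda>n. triple_term a b n j) \<longlonglongrightarrow> inverse P * ?b j" for j
  proof -
    have "(\<lambda>n. triple_term a b n j) \<longlonglongrightarrow> (- 1) ^ j *
     (inverse P * ((a * b) ^ (j choose 2) * a ^ j) - inverse P * ((a * b) ^ (Suc j choose 2) * b ^ Suc j))"
      unfolding triple_term_def P_def by (intro tendsto_intros central_qbinom_tendsto p)
    then show ?thesis by (simp add: algebra_simps)
  qed
  have bound: "norm (triple_term a b n j) \<le> C * norm a ^ j + C * norm b ^ j" for j n
  proof -
    have le: "norm (qbinom (a * b) (2 * n) k * ((a * b) ^ m * c ^ i)) \<le> C * norm c ^ i" for k m c i
    proof -
      have "norm (qbinom (a * b) (2 * n) k * ((a * b) ^ m * c ^ i))
          = norm (qbinom (a * b) (2 * n) k) * (norm (a * b) ^ m * norm c ^ i)"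
        by (simp add: norm_mult norm_power)
      also have "\<dots> \<le> C * (1 * norm c ^ i)"
        using C p by (intro mult_mono power_le_one) auto
      finally show ?thesis by simp
    qed
    have "norm (triple_term a b n j) \<le> C * norm a ^ j + C * norm b ^ Suc j"
      unfolding triple_term_def norm_mult[of "(- 1) ^ j"]
      by (simp only: norm_power norm_minus_cancel norm_one power_one mult_1_left)
        (intro order_trans[OF norm_triangle_ineq4] add_mono le)
    also have "\<dots> \<le> C * norm a ^ j + C * norm b ^ j"
      using b C by (intro add_left_mono mult_left_mono power_decreasing) auto
    finally show ?thesis .
  qed
  have "(\<Sum>j. triple_term a b n j) = qpoch a (a * b) n * qpoch b (a * b) n" for n
    unfolding finite_triple_product[OF p False, symmetric]
    by (rule suminf_finite) (auto simp: triple_term_def qbinom_def)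
  then have sum: "(\<lambda>n. \<Sum>j. triple_term a b n j) \<longlonglongrightarrow> qpoch_inf a (a * b) * qpoch_inf b (a * b)"
    using tendsto_mult[OF qpoch_tendsto[OF p] qpoch_tendsto[OF p]] by simp
  have "summable (\<lambda>j. C * norm a ^ j + C * norm b ^ j)"
    using a b by (intro summable_add summable_mult summable_geometric) auto
  from sums_by_tannery(2)[OF lim bound this sum]
  have "(\<lambda>j. P * (inverse P * ?b j)) sums (P * (qpoch_inf a (a * b) * qpoch_inf b (a * b)))"
    by (rule sums_mult)
  moreover have "P * (inverse P * ?b j) = ?b j" for j using P by (simp flip: mult.assoc)
  ultimately show ?thesis by (simp only: P_def mult.commute)
qed

section \<open>The Andrews-Gordon double sum\<close>

lemma two_geometric_has_sum:
  fixes r :: real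
  assumes "0 \<le> r" "r < 1"
  shows "((\<lambda>(j, k). r ^ j * r ^ k) has_sum (1 / (1 - r) * (1 / (1 - r)))) (UNIV :: (nat \<times> nat) set)"
proof -
  have g: "((\<lambda>k. r ^ k) has_sum (1 / (1 - r))) UNIV"
    using assms geometric_sums[of r] summable_geometric[of r]
    by (intro norm_summable_imp_has_sum) (auto simp: norm_power)
  have 1: "((\<lambda>k. r ^ j * r ^ k) has_sum (r ^ j * (1 / (1 - r)))) UNIV" for j
    by (rule has_sum_cmult_right[OF g])
  have 2: "((\<lambda>j. r ^ j * (1 / (1 - r))) has_sum (1 / (1 - r) * (1 / (1 - r)))) UNIV"
    by (rule has_sum_cmult_left[OF g])
  have "(\<lambda>(j, k). r ^ j * r ^ k) summable_on (UNIV \<times> UNIV :: (nat \<times> nat) set)"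
    by (rule summable_on_SigmaI[where g = "\<lambda>j. r ^ j * (1 / (1 - r))"])
      (use 1 2 assms in \<open>auto intro: has_sum_imp_summable\<close>)
  then have "((\<lambda>(j, k). r ^ j * r ^ k) has_sum (1 / (1 - r) * (1 / (1 - r)))) (UNIV \<times> UNIV :: (nat \<times> nat) set)"
    using 1 2 by (intro has_sum_SigmaI[where g = "\<lambda>j. r ^ j * (1 / (1 - r))"]) auto
  then show ?thesis by simp
qed

text \<open>
  With \<open>N_1 = j + k\<close> and \<open>N_2 = j\<close> the quadratic form is \<open>N_1^2 + N_2^2\<close>. The linear exponents \<open>\<alpha>\<close> and \<open>\<beta>\<close>
  serve two purposes: they distinguish the three members of the family, and they encode the variable
  \<open>x = q^n\<close> of Andrews' generating functions.
\<close>

definition ag_term :: "complex \<Rightarrow> nat \<Rightarrow> nat \<Rightarrow> nat \<times> nat \<Rightarrow> complex" where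
  "ag_term q \<alpha> \<beta> = (\<lambda>(j, k). q ^ (2 * j\<^sup>2 + 2 * j * k + k\<^sup>2 + \<alpha> * j + \<beta> * k) / (qpoch q q j * qpoch q q k))"

definition ag_sum :: "complex \<Rightarrow> nat \<Rightarrow> nat \<Rightarrow> complex" where
  "ag_sum q \<alpha> \<beta> = infsum (ag_term q \<alpha> \<beta>) UNIV"

text \<open>
  The \<open>j + k\<close> part of the exponent gives a geometric majorant; the surplus \<open>e\<close> measures how small
  the nonconstant terms become when \<open>\<alpha>\<close> and \<open>\<beta>\<close> are large.
\<close>

lemma ag_term_bound:
  assumes q: "norm q < 1"
    and C: "\<And>n. norm (inverse (qpoch q q n)) \<le> C"
    and e: "e + j + k \<le> 2 * j\<^sup>2 + 2 * j * k + k\<^sup>2 + \<alpha> * j + \<beta> * k"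
  shows "norm (ag_term q \<alpha> \<beta> (j, k)) \<le> C * C * norm q ^ e * (norm q ^ j * norm q ^ k)"
proof -
  have C0: "C \<ge> 0" using C[of 0] by simp
  have "norm (ag_term q \<alpha> \<beta> (j, k)) = norm (inverse (qpoch q q j)) * norm (inverse (qpoch q q k))
      * norm q ^ (2 * j\<^sup>2 + 2 * j * k + k\<^sup>2 + \<alpha> * j + \<beta> * k)"
    by (simp add: ag_term_def norm_mult norm_divide norm_inverse norm_power field_simps)
  also have "\<dots> \<le> C * C * norm q ^ (e + j + k)"
    using q C C0 by (intro mult_mono power_decreasing e) auto
  finally show ?thesis by (simp add: power_add mult.assoc)
qed

lemma ag_term_has_sum:
  assumes q: "norm q < 1"
  shows "(ag_term q \<alpha> \<beta> has_sum ag_sum q \<alpha> \<beta>) UNIV"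
proof -
  obtain C where "C \<ge> 1" "\<And>n. norm (qpoch q q n) \<le> C" and C: "\<And>n. norm (inverse (qpoch q q n)) \<le> C"
    using qpoch_self_bounds[OF q] by blast
  have "(\<lambda>x. norm (ag_term q \<alpha> \<beta> x)) summable_on UNIV"
  proof (rule Infinite_Sum.abs_summable_on_comparison_test')
    show "(\<lambda>x. C * C * (case x of (j, k) \<Rightarrow> norm q ^ j * norm q ^ k)) summable_on (UNIV :: (nat \<times> nat) set)"
      using two_geometric_has_sum[of "norm q"] q
      by (intro summable_on_cmult_right has_sum_imp_summable) auto
    show "norm (ag_term q \<alpha> \<beta> x) \<le> C * C * (case x of (j, k) \<Rightarrow> norm q ^ j * norm q ^ k)" for x
    proof (cases x)
      case (Pair j k)
      have "j \<le> j\<^sup>2" "k \<le> k\<^sup>2" by (auto simp: power2_eq_square)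
      then have "0 + j + k \<le> 2 * j\<^sup>2 + 2 * j * k + k\<^sup>2 + \<alpha> * j + \<beta> * k" by linarith
      from ag_term_bound[OF q C this] show ?thesis by (simp add: Pair)
    qed
  qed
  then show ?thesis
    unfolding ag_sum_def by (rule has_sum_infsum[OF abs_summable_summable])
qed

text \<open>
  Subtracting the two sums brings in a factor \<open>1 - q^j\<close>, which kills the terms with \<open>j = 0\<close> and cancels
  the last factor of \<open>(q;q)_j\<close> in the others; replacing \<open>j\<close> by \<open>j + 1\<close> restores the original shape.
\<close>

lemma ag_sum_shift_j:
  assumes q: "norm q < 1"
  shows "ag_sum q \<alpha> \<beta> = ag_sum q (\<alpha> + 1) \<beta> + q ^ (\<alpha> + 2) * ag_sum q (\<alpha> + 4) (\<beta> + 2)"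
proof -
  define f where "f = (\<lambda>(j, k). (1 - q ^ j) * ag_term q \<alpha> \<beta> (j, k))"
  define h where "h = (\<lambda>(j, k). (Suc j, k :: nat))"
  have "f \<circ> h = (\<lambda>x. q ^ (\<alpha> + 2) * ag_term q (\<alpha> + 4) (\<beta> + 2) x)"
  proof (rule ext, safe)
    fix j k
    have e: "2 * (Suc j)\<^sup>2 + 2 * Suc j * k + k\<^sup>2 + \<alpha> * Suc j + \<beta> * k
        = (\<alpha> + 2) + (2 * j\<^sup>2 + 2 * j * k + k\<^sup>2 + (\<alpha> + 4) * j + (\<beta> + 2) * k)"
      by (simp add: power2_eq_square algebra_simps)
    have cancel: "(1 - x) * (A * B / (J * (1 - x) * K)) = A * (B / (J * K))" if "1 - x \<noteq> 0" for A B J K x :: complex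
      using that by simp
    show "(f \<circ> h) (j, k) = q ^ (\<alpha> + 2) * ag_term q (\<alpha> + 4) (\<beta> + 2) (j, k)"
      unfolding f_def h_def ag_term_def o_def prod.case e power_add[of q "\<alpha> + 2"] qpoch_self_Suc[of q j]
      by (rule cancel[OF one_minus_power_Suc_nonzero[OF q]])
  qed
  then have "(f \<circ> h has_sum q ^ (\<alpha> + 2) * ag_sum q (\<alpha> + 4) (\<beta> + 2)) UNIV"
    using has_sum_cmult_right[OF ag_term_has_sum[OF q]] by simp
  moreover have "inj h" by (auto simp: h_def inj_on_def)
  ultimately have "(f has_sum q ^ (\<alpha> + 2) * ag_sum q (\<alpha> + 4) (\<beta> + 2)) (range h)"
    by (simp add: has_sum_reindex)
  moreover have "f x = 0" if "x \<notin> range h" for x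
  proof (cases x)
    case (Pair j k)
    with that have "j = 0" by (cases j) (auto simp: h_def image_def)
    then show ?thesis by (simp add: Pair f_def)
  qed
  ultimately have "(f has_sum q ^ (\<alpha> + 2) * ag_sum q (\<alpha> + 4) (\<beta> + 2)) UNIV"
    by (subst has_sum_cong_neutral[where T = "range h" and g = f]) auto
  from has_sum_add[OF ag_term_has_sum[OF q, of "\<alpha> + 1" \<beta>] this]
  have "((\<lambda>x. ag_term q (\<alpha> + 1) \<beta> x + f x) has_sum
      ag_sum q (\<alpha> + 1) \<beta> + q ^ (\<alpha> + 2) * ag_sum q (\<alpha> + 4) (\<beta> + 2)) UNIV" .
  moreover have "ag_term q (\<alpha> + 1) \<beta> x + f x = ag_term q \<alpha> \<beta> x" for x
    by (cases x) (simp add: f_def ag_term_def power_add field_simps qpoch_nonzero[OF q q])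
  ultimately show ?thesis
    using has_sum_unique[OF ag_term_has_sum[OF q]] by simp
qed

text \<open>
  The same argument with the factor \<open>1 - q^k\<close>.
\<close>

lemma ag_sum_shift_k:
  assumes q: "norm q < 1"
  shows "ag_sum q \<alpha> \<beta> = ag_sum q \<alpha> (\<beta> + 1) + q ^ (\<beta> + 1) * ag_sum q (\<alpha> + 2) (\<beta> + 2)"
proof -
  define f where "f = (\<lambda>(j, k). (1 - q ^ k) * ag_term q \<alpha> \<beta> (j, k))"
  define h where "h = (\<lambda>(j :: nat, k). (j, Suc k))"
  have "f \<circ> h = (\<lambda>x. q ^ (\<beta> + 1) * ag_term q (\<alpha> + 2) (\<beta> + 2) x)"
  proof (rule ext, safe)
    fix j k
    have e: "2 * j\<^sup>2 + 2 * j * Suc k + (Suc k)\<^sup>2 + \<alpha> * j + \<beta> * Suc k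
        = (\<beta> + 1) + (2 * j\<^sup>2 + 2 * j * k + k\<^sup>2 + (\<alpha> + 2) * j + (\<beta> + 2) * k)"
      by (simp add: power2_eq_square algebra_simps)
    have cancel: "(1 - x) * (A * B / (J * (K * (1 - x)))) = A * (B / (J * K))" if "1 - x \<noteq> 0" for A B J K x :: complex
      using that by simp
    show "(f \<circ> h) (j, k) = q ^ (\<beta> + 1) * ag_term q (\<alpha> + 2) (\<beta> + 2) (j, k)"
      unfolding f_def h_def ag_term_def o_def prod.case e power_add[of q "\<beta> + 1"] qpoch_self_Suc[of q k]
      by (rule cancel[OF one_minus_power_Suc_nonzero[OF q]])
  qed
  then have "(f \<circ> h has_sum q ^ (\<beta> + 1) * ag_sum q (\<alpha> + 2) (\<beta> + 2)) UNIV"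
    using has_sum_cmult_right[OF ag_term_has_sum[OF q]] by simp
  moreover have "inj h" by (auto simp: h_def inj_on_def)
  ultimately have "(f has_sum q ^ (\<beta> + 1) * ag_sum q (\<alpha> + 2) (\<beta> + 2)) (range h)"
    by (simp add: has_sum_reindex)
  moreover have "f x = 0" if "x \<notin> range h" for x
  proof (cases x)
    case (Pair j k)
    with that have "k = 0" by (cases k) (auto simp: h_def image_def)
    then show ?thesis by (simp add: Pair f_def)
  qed
  ultimately have "(f has_sum q ^ (\<beta> + 1) * ag_sum q (\<alpha> + 2) (\<beta> + 2)) UNIV"
    by (subst has_sum_cong_neutral[where T = "range h" and g = f]) auto
  from has_sum_add[OF ag_term_has_sum[OF q, of \<alpha> "\<beta> + 1"] this]
  have "((\<lambda>x. ag_term q \<alpha> (\<beta> + 1) x + f x) has_sum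
      ag_sum q \<alpha> (\<beta> + 1) + q ^ (\<beta> + 1) * ag_sum q (\<alpha> + 2) (\<beta> + 2)) UNIV" .
  moreover have "ag_term q \<alpha> (\<beta> + 1) x + f x = ag_term q \<alpha> \<beta> x" for x
    by (cases x) (simp add: f_def ag_term_def power_add field_simps qpoch_nonzero[OF q q])
  ultimately show ?thesis
    using has_sum_unique[OF ag_term_has_sum[OF q]] by simp
qed

text \<open>
  Only the term \<open>j = k = 0\<close> survives in the limit; the others are \<open>O(q^n)\<close> uniformly in a summable
  way.
\<close>

lemma ag_sum_tendsto_1:
  assumes q: "norm q < 1" and ge: "\<And>n. n \<le> \<alpha> n" "\<And>n. n \<le> \<beta> n"
  shows "(\<lambda>n. ag_sum q (\<alpha> n) (\<beta> n)) \<longlonglongrightarrow> 1"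
proof -
  obtain C where "C \<ge> 1" "\<And>n. norm (qpoch q q n) \<le> C" and C: "\<And>n. norm (inverse (qpoch q q n)) \<le> C"
    using qpoch_self_bounds[OF q] by blast
  let ?S = "1 / (1 - norm q) * (1 / (1 - norm q))"
  let ?g = "\<lambda>n x. C * C * norm q ^ n * (case x of (j, k) \<Rightarrow> norm q ^ j * norm q ^ k)"
  have bound: "norm (ag_sum q (\<alpha> n) (\<beta> n) - 1) \<le> C * C * norm q ^ n * ?S" for n
  proof (rule norm_infsum_le)
    let ?f = "\<lambda>x. if x = (0, 0) then 0 else ag_term q (\<alpha> n) (\<beta> n) x"
    let ?d = "\<lambda>x. if x = (0, 0) then - 1 else (0 :: complex)"
    have "(?d has_sum (- 1)) UNIV"
      by (rule has_sum_finite_neutralI[where B = "{(0, 0)}"]) auto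
    from has_sum_add[OF ag_term_has_sum[OF q, of "\<alpha> n" "\<beta> n"] this]
    moreover have "(\<lambda>x. ag_term q (\<alpha> n) (\<beta> n) x + ?d x) = ?f"
      by (auto simp: fun_eq_iff ag_term_def)
    ultimately show "(?f has_sum ag_sum q (\<alpha> n) (\<beta> n) - 1) UNIV" by simp
    show "(?g n has_sum C * C * norm q ^ n * ?S) UNIV"
      using two_geometric_has_sum[of "norm q"] q by (intro has_sum_cmult_right) auto
    show "norm (?f x) \<le> ?g n x" for x
    proof (cases "x = (0, 0)")
      case True
      then show ?thesis by simp
    next
      case False
      obtain j k where x: "x = (j, k)" by (cases x)
      have "n \<le> \<alpha> n * j + \<beta> n * k"
      proof (cases "j = 0")
        case True
        then have "k \<ge> 1" using False x by simp
        then show ?thesis using mult_le_mono[OF ge(2)[of n], of 1 k] by simp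
      next
        case False
        then show ?thesis using mult_le_mono[OF ge(1)[of n], of 1 j] by simp
      qed
      moreover have "j \<le> j\<^sup>2" "k \<le> k\<^sup>2" by (auto simp: power2_eq_square)
      ultimately have "n + j + k \<le> 2 * j\<^sup>2 + 2 * j * k + k\<^sup>2 + \<alpha> n * j + \<beta> n * k" by linarith
      from ag_term_bound[OF q C this] False show ?thesis by (simp add: x)
    qed
  qed
  have "(\<lambda>n. norm q ^ n) \<longlonglongrightarrow> 0"
    using q by (intro LIMSEQ_power_zero) simp
  then have "(\<lambda>n. C * C * norm q ^ n * ?S) \<longlonglongrightarrow> 0"
    by (intro tendsto_mult_left_zero tendsto_mult_right_zero)
  with always_eventually have "(\<lambda>n. ag_sum q (\<alpha> n) (\<beta> n) - 1) \<longlonglongrightarrow> 0"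
    by (rule Lim_null_comparison) (use bound in blast)
  then show ?thesis by (simp add: LIM_zero_iff)
qed

section \<open>Uniqueness for the recursion\<close>

text \<open>
  The recursion that the Andrews-Gordon sums satisfy determines them by their limits. If \<open>M n\<close> is the
  largest of the three absolute values, then \<open>M n \<le> (1 + 2 \<bar>q\<bar>^(n+1)) M (n + 1)\<close>. The product
  of these factors converges, so going from \<open>n\<close> to infinity costs only a bounded factor, while \<open>M\<close>
  tends to zero.
\<close>

lemma linear_recursion_trivial:
  fixes D1 D2 D3 :: "nat \<Rightarrow> complex"
  assumes q: "norm (q :: complex) < 1"
    and rec1: "\<And>n. D1 n = D3 (Suc n)"
    and rec2: "\<And>n. D2 n = D1 n + q ^ Suc n * D2 (Suc n)"
    and rec3: "\<And>n. D3 n = D2 n + (q ^ Suc n)\<^sup>2 * D1 (Suc n)"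
    and lim: "D1 \<longlonglongrightarrow> 0" "D2 \<longlonglongrightarrow> 0" "D3 \<longlonglongrightarrow> 0"
  shows "D1 n = 0" and "D2 n = 0" and "D3 n = 0"
proof -
  define r where "r = norm q"
  have r: "0 \<le> r" "r < 1" using q by (auto simp: r_def)
  define M where "M = (\<lambda>n. max (norm (D1 n)) (max (norm (D2 n)) (norm (D3 n))))"
  have M: "norm (D1 n) \<le> M n" "norm (D2 n) \<le> M n" "norm (D3 n) \<le> M n" "0 \<le> M n" for n
    by (auto simp: M_def le_max_iff_disj)
  have Mlim: "M \<longlonglongrightarrow> max (norm (0::complex)) (max (norm (0::complex)) (norm (0::complex)))"
    unfolding M_def by (intro tendsto_max tendsto_norm lim)
  (* s n is the tail of the series of 2 r^(m+1), so exp (- s n) * M n is increasing. *)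
  define s where "s = (\<lambda>n. 2 * r ^ Suc n / (1 - r))"
  have s: "s n = s (Suc n) + 2 * r ^ Suc n" for n
    using r by (simp add: s_def field_simps)
  have step: "M n \<le> exp (2 * r ^ Suc n) * M (Suc n)" for n
  proof -
    define t where "t = r ^ Suc n"
    have t: "0 \<le> t" "t \<le> 1" using r unfolding t_def by (auto intro: power_le_one simp del: power_Suc)
    have tt: "t\<^sup>2 \<le> t" using t by (simp add: power2_eq_square mult_left_le)
    have 1: "norm (D1 n) \<le> M (Suc n)" using M rec1 by simp
    have 2: "norm (D2 n) \<le> (1 + t) * M (Suc n)"
    proof -
      have "norm (D2 n) \<le> norm (D1 n) + t * norm (D2 (Suc n))"
        unfolding rec2[of n] by (rule order_trans[OF norm_triangle_ineq])
          (simp add: norm_mult norm_power t_def r_def)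
      also have "\<dots> \<le> M (Suc n) + t * M (Suc n)"
        using 1 M t by (intro add_mono mult_left_mono) auto
      finally show ?thesis by (simp add: algebra_simps)
    qed
    have 3: "norm (D3 n) \<le> (1 + 2 * t) * M (Suc n)"
    proof -
      have "norm (D3 n) \<le> norm (D2 n) + t\<^sup>2 * norm (D1 (Suc n))"
        unfolding rec3[of n] by (rule order_trans[OF norm_triangle_ineq])
          (simp add: norm_mult norm_power t_def r_def)
      also have "\<dots> \<le> (1 + t) * M (Suc n) + t * M (Suc n)"
        using 2 M t tt by (intro add_mono mult_mono) auto
      finally show ?thesis by (simp add: algebra_simps)
    qed
    have "1 * M (Suc n) \<le> (1 + 2 * t) * M (Suc n)" "(1 + t) * M (Suc n) \<le> (1 + 2 * t) * M (Suc n)"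
      using t M by (intro mult_right_mono; simp)+
    with 1 2 3 have "M n \<le> (1 + 2 * t) * M (Suc n)"
      unfolding M_def[THEN fun_cong, of n] by simp
    also have "\<dots> \<le> exp (2 * t) * M (Suc n)"
      using exp_ge_add_one_self[of "2 * t"] M by (intro mult_right_mono) auto
    finally show ?thesis by (simp add: t_def)
  qed
  have "exp (- s n) * M n \<le> exp (- s (Suc n)) * M (Suc n)" for n
  proof -
    have "exp (- s n) * M n \<le> exp (- s n) * (exp (2 * r ^ Suc n) * M (Suc n))"
      by (intro mult_left_mono step) auto
    also have "\<dots> = exp (- s (Suc n)) * M (Suc n)"
      unfolding s[of n] mult.assoc[symmetric] exp_add[symmetric] by simp
    finally show ?thesis .
  qed
  then have inc: "incseq (\<lambda>n. exp (- s n) * M n)" by (rule incseq_SucI)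
  have "(\<lambda>n. exp (- s n) * M n) \<longlonglongrightarrow> exp (- (2 * 0 / (1 - r))) * 0"
    using Mlim r unfolding s_def by (intro tendsto_intros LIMSEQ_Suc[OF LIMSEQ_power_zero]) auto
  then have "exp (- s n) * M n \<le> 0" for n
    using incseq_le[OF inc, of 0] by simp
  then have "M n \<le> 0" by (simp add: mult_le_0_iff)
  with M[of n] have "norm (D1 n) \<le> 0" "norm (D2 n) \<le> 0" "norm (D3 n) \<le> 0"
    by linarith+
  then show "D1 n = 0" "D2 n = 0" "D3 n = 0" by simp_all
qed

section \<open>The alternating series\<close>

text \<open>
  Andrews' function \<open>J_(3,i)(x)\<close> at \<open>x = q^n\<close>, multiplied by \<open>(q;q)_\<infinity>\<close>. The factor
  \<open>1 / (x q^(m+1);q)_\<infinity>\<close> then becomes the finite product \<open>(q;q)_(n+m)\<close>. The usual exponent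
  \<open>7m(m+1)/2 - im\<close> is written \<open>7m(m-1)/2 + (7-i)m\<close>, where the natural-number subtraction is exact
  for \<open>i \<le> 7\<close>.
\<close>

definition ag_alt_term :: "complex \<Rightarrow> nat \<Rightarrow> nat \<Rightarrow> nat \<Rightarrow> complex" where
  "ag_alt_term q i n m = (- 1) ^ m * q ^ (3 * n * m + 7 * (m choose 2) + (7 - i) * m)
     * (1 - q ^ (i * (n + 2 * m + 1))) * (qpoch q q (n + m) / qpoch q q m)"

definition ag_alt :: "complex \<Rightarrow> nat \<Rightarrow> nat \<Rightarrow> complex" where
  "ag_alt q i n = (\<Sum>m. ag_alt_term q i n m)"

lemma ag_alt_term_bound:
  assumes q: "norm q < 1" and i: "i \<le> 3"
    and C: "\<And>n. norm (qpoch q q n) \<le> C" "\<And>n. norm (inverse (qpoch q q n)) \<le> C"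
  shows "norm (ag_alt_term q i n m) \<le> 2 * (C * C) * norm q ^ m"
proof -
  have C0: "C \<ge> 0" using C(2)[of 0] by simp
  have "1 * m \<le> (7 - i) * m" using i by (intro mult_le_mono) auto
  then have "m \<le> 3 * n * m + 7 * (m choose 2) + (7 - i) * m" by linarith
  then have 1: "norm q ^ (3 * n * m + 7 * (m choose 2) + (7 - i) * m) \<le> norm q ^ m"
    using q by (intro power_decreasing) auto
  have "norm (1 - q ^ (i * (n + 2 * m + 1))) \<le> norm (1 :: complex) + norm (q ^ (i * (n + 2 * m + 1)))"
    by (rule norm_triangle_ineq4)
  also have "\<dots> \<le> 1 + 1"
    unfolding norm_power norm_one using q by (intro add_left_mono power_le_one) auto
  finally have 2: "norm (1 - q ^ (i * (n + 2 * m + 1))) \<le> 2" by simp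
  have "norm (ag_alt_term q i n m) = norm q ^ (3 * n * m + 7 * (m choose 2) + (7 - i) * m)
      * norm (1 - q ^ (i * (n + 2 * m + 1))) * (norm (qpoch q q (n + m)) * norm (inverse (qpoch q q m)))"
    by (simp only: ag_alt_term_def norm_mult norm_power norm_minus_cancel norm_one power_one
        divide_inverse mult_1_left)
  also have "\<dots> \<le> norm q ^ m * 2 * (C * C)"
    using C C0 by (intro mult_mono 1 2) auto
  finally show ?thesis by (simp only: mult_ac)
qed

lemma ag_alt_sums:
  assumes q: "norm q < 1" and i: "i \<le> 3"
  shows "ag_alt_term q i n sums ag_alt q i n"
proof -
  obtain C where C: "C \<ge> 1" "\<And>n. norm (qpoch q q n) \<le> C" "\<And>n. norm (inverse (qpoch q q n)) \<le> C"
    using qpoch_self_bounds[OF q] by blast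
  have "summable (\<lambda>m. 2 * (C * C) * norm q ^ m)"
    using q by (intro summable_mult summable_geometric) simp
  then have "summable (ag_alt_term q i n)"
    by (rule summable_comparison_test'[where N = 0]) (rule ag_alt_term_bound[OF q i C(2,3)])
  then show ?thesis unfolding ag_alt_def by (rule summable_sums)
qed

lemma ag_alt_0 [simp]: "ag_alt q 0 n = 0"
  by (simp add: ag_alt_def ag_alt_term_def)

text \<open>
  Let \<open>w = q^(e(n+2m+1))\<close>. The m-th terms for \<open>e + 1\<close> and \<open>e\<close> differ by a multiple of
  \<open>(1 - w q^(n+2m+1)) - q^m (1 - w) = (1 - q^m) + w q^m (1 - q^(n+m+1))\<close>.
  The factor \<open>1 - q^(n+m+1)\<close> extends \<open>(q;q)_(n+m)\<close>; the factor \<open>1 - q^m\<close> shortens \<open>(q;q)_m\<close>, and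
  after a shift of \<open>m\<close> both parts combine to a term at \<open>n + 1\<close>. The shift appears as the telescoping
  sequence \<open>A\<close>. Writing the indices as \<open>e + 1\<close> and \<open>d + 1\<close> with \<open>e + d = 2\<close> covers the three
  recursions at once.
\<close>

lemma ag_alt_recursion:
  assumes q: "norm q < 1" and ed: "e + d = 2"
  shows "ag_alt q (e + 1) n = ag_alt q e n + q ^ (e * (n + 1)) * ag_alt q (d + 1) (n + 1)"
proof -
  define A where "A = (\<lambda>m. (- 1) ^ m * q ^ (3 * n * m + 7 * (m choose 2) + (d + 4) * m)
    * (1 - q ^ m) * (qpoch q q (n + m) / qpoch q q m))"
  have step: "ag_alt_term q (e + 1) n m - ag_alt_term q e n m
      - q ^ (e * (n + 1)) * ag_alt_term q (d + 1) (n + 1) m = A m - A (Suc m)" for m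
  proof -
    (* From here on the claim is a polynomial identity in q, x = q^n, y = q^m, W and V. *)
    define W V x y where "W = q ^ (3 * n * m)" and "V = q ^ (7 * (m choose 2))"
      and "x = q ^ n" and "y = q ^ m"
    define s g where "s = (- 1 :: complex) ^ m" and "g = qpoch q q (n + m) / qpoch q q m"
    have s7: "7 - (e + 1) = d + 4" "7 - e = d + 5" "7 - (d + 1) = e + 4" using ed by auto
    have p1: "q ^ (3 * n * m + 7 * (m choose 2) + c * m) = W * V * y ^ c" for c
      by (simp add: W_def V_def y_def power_add flip: power_mult) (simp add: mult.commute)
    have y2: "y\<^sup>2 = q ^ (2 * m)" by (simp only: y_def power_mult[symmetric] mult.commute)
    have p2: "q ^ (i * (n + 2 * m + 1)) = (x * y\<^sup>2 * q) ^ i" for i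
    proof -
      have "x * y\<^sup>2 * q = q ^ (n + 2 * m + 1)"
        unfolding x_def y2 power_add by simp
      then show ?thesis by (simp only: power_mult mult.commute[of i])
    qed
    have p3: "q ^ (i * (n + 1 + 2 * m + 1)) = (x * y\<^sup>2 * q\<^sup>2) ^ i" for i
    proof -
      have "x * y\<^sup>2 * q\<^sup>2 = q ^ (n + 1 + 2 * m + 1)"
        unfolding x_def y2 power_add by (simp add: power2_eq_square)
      then show ?thesis by (simp only: power_mult mult.commute[of i])
    qed
    have p4: "q ^ (3 * (n + 1) * m + 7 * (m choose 2) + c * m) = W * y ^ 3 * V * y ^ c" for c
    proof -
      have "3 * (n + 1) * m + 7 * (m choose 2) + c * m = (3 * n * m + 7 * (m choose 2) + c * m) + 3 * m"
        by (simp add: algebra_simps)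
      moreover have y3: "q ^ (3 * m) = y ^ 3" by (simp add: y_def mult.commute flip: power_mult)
      ultimately have "q ^ (3 * (n + 1) * m + 7 * (m choose 2) + c * m) = W * V * y ^ c * y ^ 3"
        by (simp only: power_add[of q "3 * n * m + 7 * (m choose 2) + c * m" "3 * m"] p1 y3)
      then show ?thesis by (simp only: mult_ac)
    qed
    have p5: "q ^ (3 * n * Suc m + 7 * (Suc m choose 2) + c * Suc m) = W * x ^ 3 * V * y ^ 7 * (y * q) ^ c" for c
    proof -
      have "3 * n * Suc m + 7 * (Suc m choose 2) + c * Suc m
          = 3 * n * m + n * 3 + 7 * (m choose 2) + m * 7 + Suc m * c"
        by (simp add: Suc_choose_two algebra_simps)
      moreover have "y * q = q ^ Suc m" by (simp add: y_def)
      ultimately show ?thesis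
        by (simp only: W_def V_def x_def y_def power_add power_mult)
    qed
    have p6: "q ^ (e * (n + 1)) = (x * q) ^ e"
    proof -
      have "x * q = q ^ (n + 1)" by (simp add: x_def)
      then show ?thesis by (simp only: power_mult mult.commute[of e])
    qed
    have nz: "1 - y * q \<noteq> 0"
      using qpoch_factor_nonzero[OF q q, of m] by (simp add: y_def mult.commute)
    have g1: "qpoch q q (n + 1 + m) / qpoch q q m = g * (1 - x * y * q)"
      by (simp add: g_def qpoch_Suc x_def y_def power_add mult.commute mult.left_commute)
    have g2: "(1 - q ^ Suc m) * (qpoch q q (n + Suc m) / qpoch q q (Suc m)) = g * (1 - x * y * q)"
      using nz by (simp add: g_def qpoch_Suc x_def y_def power_add mult.commute mult.left_commute)
    have t1: "ag_alt_term q (e + 1) n m = s * (W * V * y ^ (d + 4)) * (1 - (x * y\<^sup>2 * q) ^ (e + 1)) * g"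
      unfolding ag_alt_term_def s7 p1 p2 s_def g_def ..
    have t2: "ag_alt_term q e n m = s * (W * V * y ^ (d + 5)) * (1 - (x * y\<^sup>2 * q) ^ e) * g"
      unfolding ag_alt_term_def s7 p1 p2 s_def g_def ..
    have t3: "ag_alt_term q (d + 1) (n + 1) m
        = s * (W * y ^ 3 * V * y ^ (e + 4)) * (1 - (x * y\<^sup>2 * q\<^sup>2) ^ (d + 1)) * (g * (1 - x * y * q))"
      unfolding ag_alt_term_def s7 p3 p4 s_def g1 ..
    have a1: "A m = s * (W * V * y ^ (d + 4)) * (1 - y) * g"
      unfolding A_def p1 s_def g_def y_def ..
    have a2: "A (Suc m) = - s * (W * x ^ 3 * V * y ^ 7 * (y * q) ^ (d + 4)) * (g * (1 - x * y * q))"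
      unfolding A_def p5 mult.assoc[of _ "1 - q ^ Suc m"] g2 s_def by simp
    consider "e = 0" "d = 2" | "e = 1" "d = 1" | "e = 2" "d = 0" using ed by linarith
    then have h: "y ^ (d + 5) * (x * y\<^sup>2 * q) ^ e = y ^ 3 * y ^ (e + 4) * (x * q) ^ e \<and>
      y ^ 3 * y ^ (e + 4) * (x * q) ^ e * (x * y\<^sup>2 * q\<^sup>2) ^ (d + 1) = x ^ 3 * y ^ 7 * (y * q) ^ (d + 4)"
      by cases (simp_all add: power_mult_distrib power_add power2_eq_square power3_eq_cube numeral_eq_Suc)
    have key: "s * (W * V * Y4) * (1 - z * (x * y\<^sup>2 * q)) * g - s * (W * V * (Y4 * y)) * (1 - z) * g
      - p * (s * (W * y ^ 3 * V * E4) * (1 - Z) * (g * (1 - x * y * q)))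
      = s * (W * V * Y4) * (1 - y) * g - (- s * (W * x ^ 3 * V * y ^ 7 * Q) * (g * (1 - x * y * q)))"
      if "Y4 * y * z = y ^ 3 * E4 * p \<and> y ^ 3 * E4 * p * Z = x ^ 3 * y ^ 7 * Q" for Y4 z p E4 Z Q
      using that[THEN conjunct1] that[THEN conjunct2] by algebra
    have y5: "y ^ (d + 5) = y ^ (d + 4) * y"
      by (simp add: numeral_eq_Suc)
    show ?thesis
      unfolding t1 t2 t3 a1 a2 p6 y5 power_add[of "x * y\<^sup>2 * q" e 1] power_one_right
      by (rule key[OF h[unfolded y5]])
  qed
  obtain C where C: "C \<ge> 1" "\<And>n. norm (qpoch q q n) \<le> C" "\<And>n. norm (inverse (qpoch q q n)) \<le> C"
    using qpoch_self_bounds[OF q] by blast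
  have "A \<longlonglongrightarrow> 0"
  proof (rule Lim_null_comparison[OF always_eventually])
    show "\<forall>m. norm (A m) \<le> 2 * (C * C) * norm q ^ m"
    proof
      fix m
      have "1 * m \<le> (d + 4) * m" by (intro mult_le_mono) auto
      then have "m \<le> 3 * n * m + 7 * (m choose 2) + (d + 4) * m" by linarith
      then have 1: "norm q ^ (3 * n * m + 7 * (m choose 2) + (d + 4) * m) \<le> norm q ^ m"
        using q by (intro power_decreasing) auto
      have "norm (1 - q ^ m) \<le> norm (1 :: complex) + norm (q ^ m)"
        by (rule norm_triangle_ineq4)
      also have "\<dots> \<le> 1 + 1"
        unfolding norm_power norm_one using q by (intro add_left_mono power_le_one) auto
      finally have 2: "norm (1 - q ^ m) \<le> 2" by simp
      have "norm (A m) = norm q ^ (3 * n * m + 7 * (m choose 2) + (d + 4) * m)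
          * norm (1 - q ^ m) * (norm (qpoch q q (n + m)) * norm (inverse (qpoch q q m)))"
        by (simp only: A_def norm_mult norm_power norm_minus_cancel norm_one power_one
            divide_inverse mult_1_left)
      also have "\<dots> \<le> norm q ^ m * 2 * (C * C)"
        using C by (intro mult_mono 1 2) auto
      finally show "norm (A m) \<le> 2 * (C * C) * norm q ^ m" by (simp only: mult_ac)
    qed
    have "(\<lambda>n. norm q ^ n) \<longlonglongrightarrow> 0"
      using q by (intro LIMSEQ_power_zero) simp
    then show "(\<lambda>m. 2 * (C * C) * norm q ^ m) \<longlonglongrightarrow> 0"
      by (intro tendsto_mult_right_zero)
  qed
  then have "(\<lambda>m. A m - A (Suc m)) sums (A 0 - 0)" by (rule telescope_sums')
  moreover have "A 0 = 0" by (simp add: A_def)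
  moreover have "(\<lambda>m. ag_alt_term q (e + 1) n m - ag_alt_term q e n m
      - q ^ (e * (n + 1)) * ag_alt_term q (d + 1) (n + 1) m) sums
      (ag_alt q (e + 1) n - ag_alt q e n - q ^ (e * (n + 1)) * ag_alt q (d + 1) (n + 1))"
    using ed by (intro sums_diff sums_mult ag_alt_sums q) auto
  ultimately have "ag_alt q (e + 1) n - ag_alt q e n - q ^ (e * (n + 1)) * ag_alt q (d + 1) (n + 1) = 0"
    unfolding step using sums_unique2 by fastforce
  then show ?thesis by (simp add: algebra_simps)
qed

text \<open>
  As \<open>n\<close> grows the factor \<open>q^(3nm)\<close> leaves only \<open>m = 0\<close>. For \<open>i = 0\<close> the series vanishes identically, hence
  the lower bound on \<open>i\<close>.
\<close>

lemma ag_alt_tendsto: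
  assumes q: "norm q < 1" and i: "1 \<le> i" "i \<le> 3"
  shows "ag_alt q i \<longlonglongrightarrow> qpoch_inf q q"
proof -
  obtain C where C: "C \<ge> 1" "\<And>n. norm (qpoch q q n) \<le> C" "\<And>n. norm (inverse (qpoch q q n)) \<le> C"
    using qpoch_self_bounds[OF q] by blast
  have zero: "(\<lambda>n. q ^ n) \<longlonglongrightarrow> 0" using q by (rule LIMSEQ_power_zero)
  have lim: "(\<lambda>n. ag_alt_term q i n m) \<longlonglongrightarrow> (if m = 0 then qpoch_inf q q else 0)" for m
  proof -
    have "(\<lambda>n. q ^ (n + 2 * m + 1)) \<longlonglongrightarrow> 0"
      using LIMSEQ_ignore_initial_segment[OF zero, of "2 * m + 1"] by (simp add: add.assoc)
    then have "(\<lambda>n. (q ^ (n + 2 * m + 1)) ^ i) \<longlonglongrightarrow> 0 ^ i" by (rule tendsto_power)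
    then have 1: "(\<lambda>n. q ^ (i * (n + 2 * m + 1))) \<longlonglongrightarrow> 0"
      using i by (simp only: power_mult[symmetric] mult.commute[of i]) (simp add: zero_power)
    have 2: "(\<lambda>n. q ^ (3 * n * m)) \<longlonglongrightarrow> (if m = 0 then 1 else 0)"
    proof (cases "m = 0")
      case False
      have "(\<lambda>n. (q ^ n) ^ (3 * m)) \<longlonglongrightarrow> 0 ^ (3 * m)" using zero by (rule tendsto_power)
      then show ?thesis using False by (simp add: zero_power mult_ac flip: power_mult)
    qed simp
    have 3: "(\<lambda>n. qpoch q q (n + m)) \<longlonglongrightarrow> qpoch_inf q q"
      by (rule LIMSEQ_ignore_initial_segment[OF qpoch_tendsto[OF q]])
    have "(\<lambda>n. (- 1) ^ m * (q ^ (3 * n * m) * q ^ (7 * (m choose 2) + (7 - i) * m))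
        * (1 - q ^ (i * (n + 2 * m + 1))) * (qpoch q q (n + m) / qpoch q q m))
        \<longlonglongrightarrow> (- 1) ^ m * ((if m = 0 then 1 else 0) * q ^ (7 * (m choose 2) + (7 - i) * m))
        * (1 - 0) * (qpoch_inf q q / qpoch q q m)"
      by (intro tendsto_intros 1 2 3 qpoch_nonzero q)
    moreover have "q ^ (3 * n * m) * q ^ (7 * (m choose 2) + (7 - i) * m)
        = q ^ (3 * n * m + 7 * (m choose 2) + (7 - i) * m)" for n
      by (simp only: power_add mult.assoc)
    ultimately show ?thesis
      by (cases "m = 0") (simp_all add: ag_alt_term_def binomial_eq_0)
  qed
  have "summable (\<lambda>m. 2 * (C * C) * norm q ^ m)"
    using q by (intro summable_mult summable_geometric) simp
  then have "(\<lambda>n. \<Sum>m. ag_alt_term q i n m) \<longlonglongrightarrow> (\<Sum>m. if m = 0 then qpoch_inf q q else 0)"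
    using tannerys_theorem[OF lim _ \<open>summable (\<lambda>m. 2 * (C * C) * norm q ^ m)\<close>]
      ag_alt_term_bound[OF q i(2) C(2,3)] by (simp add: split_def)
  moreover have "(\<Sum>m. if m = 0 then qpoch_inf q q else 0) = qpoch_inf q q"
    using suminf_finite[of "{0 :: nat}" "\<lambda>m. if m = 0 then qpoch_inf q q else 0"] by simp
  ultimately show ?thesis by (simp add: ag_alt_def[abs_def])
qed

text \<open>
  At \<open>n = 0\<close> the factorials cancel and the series is the triple product with \<open>a = q^(7-i)\<close> and \<open>b = q^i\<close>.
\<close>

lemma ag_alt_product:
  assumes q: "norm q < 1" and i: "1 \<le> i" "i \<le> 3"
  shows "ag_alt q i 0 = qpoch_inf_list [q ^ i, q ^ (7 - i), q ^ 7] (q ^ 7)"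
proof -
  have ab: "q ^ (7 - i) * q ^ i = q ^ 7"
    using i by (simp flip: power_add)
  have "norm q ^ k < 1" if "k > 0" for k
    using q that by (simp add: power_less_one_iff)
  then have n: "norm (q ^ (7 - i)) < 1" "norm (q ^ i) < 1"
    using i by (simp_all add: norm_power)
  have "(- 1) ^ m * ((q ^ 7) ^ (m choose 2) * (q ^ (7 - i)) ^ m - (q ^ 7) ^ (Suc m choose 2) * (q ^ i) ^ Suc m)
      = ag_alt_term q i 0 m" for m
  proof -
    have "7 * (Suc m choose 2) + i * Suc m = 7 * (m choose 2) + (7 - i) * m + i * (2 * m + 1)"
    proof -
      have "7 * m = (7 - i) * m + i * m" using i by (simp flip: add_mult_distrib)
      then show ?thesis by (simp add: Suc_choose_two algebra_simps)
    qed
    then have "(q ^ 7) ^ (Suc m choose 2) * (q ^ i) ^ Suc m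
        = q ^ (7 * (m choose 2) + (7 - i) * m) * q ^ (i * (2 * m + 1))"
      by (simp only: power_mult[symmetric] power_add[symmetric])
    moreover have "(q ^ 7) ^ (m choose 2) * (q ^ (7 - i)) ^ m = q ^ (7 * (m choose 2) + (7 - i) * m)"
      by (simp only: power_mult[symmetric] power_add[symmetric])
    ultimately show ?thesis
      using qpoch_nonzero[OF q q, of m] by (simp add: ag_alt_term_def right_diff_distrib del: power_Suc)
  qed
  then have "ag_alt_term q i 0 sums
      (qpoch_inf (q ^ (7 - i)) (q ^ 7) * qpoch_inf (q ^ i) (q ^ 7) * qpoch_inf (q ^ 7) (q ^ 7))"
    using jacobi_triple_product[OF n] unfolding ab by simp
  then have "ag_alt q i 0 = qpoch_inf (q ^ (7 - i)) (q ^ 7) * qpoch_inf (q ^ i) (q ^ 7) * qpoch_inf (q ^ 7) (q ^ 7)"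
    unfolding ag_alt_def by (rule sums_unique[symmetric])
  then show ?thesis by (simp add: qpoch_inf_list_def mult_ac)
qed

section \<open>The Andrews-Gordon identities modulo 7\<close>

text \<open>
  The sums with \<open>(\<alpha>, \<beta>)\<close> equal to \<open>(2n+2, n+1)\<close>, \<open>(2n+1, n)\<close> and \<open>(2n, n)\<close>, multiplied by \<open>(q;q)_\<infinity>\<close>, satisfy the
  recursion of the alternating series with \<open>i = 1, 2, 3\<close> and have the same limit. Hence they agree for every \<open>n\<close>, in particular
  for \<open>n = 0\<close>, where the triple product applies.
\<close>

theorem andrews_gordon_mod_7:
  assumes q: "norm q < 1"
  shows "ag_sum q 2 1 = qpoch_inf_list [q, q ^ 6, q ^ 7] (q ^ 7) / qpoch_inf q q"
    and "ag_sum q 1 0 = qpoch_inf_list [q ^ 2, q ^ 5, q ^ 7] (q ^ 7) / qpoch_inf q q"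
    and "ag_sum q 0 0 = qpoch_inf_list [q ^ 3, q ^ 4, q ^ 7] (q ^ 7) / qpoch_inf q q"
proof -
  define P where "P = qpoch_inf q q"
  have P: "P \<noteq> 0" unfolding P_def by (rule qpoch_inf_nonzero[OF q q])
  define R1 R2 R3 where "R1 = (\<lambda>n. ag_sum q (2 * n + 2) (n + 1))"
    and "R2 = (\<lambda>n. ag_sum q (2 * n + 1) n)" and "R3 = (\<lambda>n. ag_sum q (2 * n) n)"
  define D1 D2 D3 where "D1 = (\<lambda>n. P * R1 n - ag_alt q 1 n)"
    and "D2 = (\<lambda>n. P * R2 n - ag_alt q 2 n)" and "D3 = (\<lambda>n. P * R3 n - ag_alt q 3 n)"
  have r1: "R1 n = R3 (Suc n)" for n by (simp add: R1_def R3_def)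
  (* Move from (2n+1, n) to (2n+2, n+1) in two steps; the surplus terms are q^(n+1)
     times the expansion of R2 (Suc n) in the direction of k. *)
  have r2: "R2 n = R1 n + q ^ Suc n * R2 (Suc n)" for n
  proof -
    have "R2 n = ag_sum q (2 * n + 1) (n + 1) + q ^ (n + 1) * ag_sum q (2 * n + 3) (n + 2)"
      using ag_sum_shift_k[OF q, of "2 * n + 1" n] by (simp add: R2_def numeral_eq_Suc)
    also have "ag_sum q (2 * n + 1) (n + 1)
        = R1 n + q ^ (2 * n + 3) * ag_sum q (2 * n + 5) (n + 3)"
      using ag_sum_shift_j[OF q, of "2 * n + 1" "n + 1"] by (simp add: R1_def numeral_eq_Suc)
    also have "ag_sum q (2 * n + 3) (n + 2)
        = R2 (Suc n) - q ^ (n + 2) * ag_sum q (2 * n + 5) (n + 3)"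
      using ag_sum_shift_k[OF q, of "2 * n + 3" "n + 1"] by (simp add: R2_def numeral_eq_Suc)
    also have "q ^ (2 * n + 3) = q ^ (n + 1) * q ^ (n + 2)"
      unfolding power_add[symmetric] by (rule arg_cong[where f = "\<lambda>k. q ^ k"]) simp
    finally show ?thesis by (simp add: algebra_simps)
  qed
  have r3: "R3 n = R2 n + (q ^ Suc n)\<^sup>2 * R1 (Suc n)" for n
  proof -
    have "(q ^ Suc n)\<^sup>2 = q ^ (2 * n + 2)"
      by (simp add: power2_eq_square power_add mult_2)
    moreover have "R1 (Suc n) = ag_sum q (2 * n + 4) (n + 2)"
      unfolding R1_def by (rule arg_cong2[where f = "ag_sum q"]) auto
    ultimately show ?thesis
      using ag_sum_shift_j[OF q, of "2 * n" n] by (simp only: R2_def R3_def)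
  qed
  have a1: "ag_alt q 1 n = ag_alt q 3 (Suc n)" for n
    using ag_alt_recursion[OF q, of 0 2 n] by simp
  have a2: "ag_alt q 2 n = ag_alt q 1 n + q ^ Suc n * ag_alt q 2 (Suc n)" for n
    using ag_alt_recursion[OF q, of 1 1 n] by (simp add: numeral_2_eq_2)
  have a3: "ag_alt q 3 n = ag_alt q 2 n + (q ^ Suc n)\<^sup>2 * ag_alt q 1 (Suc n)" for n
  proof -
    have "q ^ (2 * (n + 1)) = (q ^ Suc n)\<^sup>2"
      by (simp add: power2_eq_square power_add mult_2)
    then show ?thesis using ag_alt_recursion[OF q, of 2 0 n] by simp
  qed
  have lim: "D1 \<longlonglongrightarrow> P * 1 - P" "D2 \<longlonglongrightarrow> P * 1 - P" "D3 \<longlonglongrightarrow> P * 1 - P"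
    unfolding D1_def D2_def D3_def P_def R1_def R2_def R3_def
    by (intro tendsto_diff tendsto_mult_left ag_sum_tendsto_1 ag_alt_tendsto q; simp)+
  have d1: "D1 n = D3 (Suc n)" for n
    by (simp only: D1_def D3_def r1[of n] a1[of n])
  have d2: "D2 n = D1 n + q ^ Suc n * D2 (Suc n)" for n
    unfolding D1_def D2_def r2[of n] a2[of n] by (simp only: algebra_simps)
  have d3: "D3 n = D2 n + (q ^ Suc n)\<^sup>2 * D1 (Suc n)" for n
    unfolding D1_def D2_def D3_def r3[of n] a3[of n] by (simp only: algebra_simps)
  note D = linear_recursion_trivial[OF q d1 d2 d3, of 0] and lim' = lim[unfolded mult_1_right diff_self]
  show "ag_sum q 2 1 = qpoch_inf_list [q, q ^ 6, q ^ 7] (q ^ 7) / qpoch_inf q q"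
    using D(1)[OF lim'] P ag_alt_product[OF q, of 1] by (simp add: D1_def R1_def P_def field_simps numeral_2_eq_2)
  show "ag_sum q 1 0 = qpoch_inf_list [q ^ 2, q ^ 5, q ^ 7] (q ^ 7) / qpoch_inf q q"
    using D(2)[OF lim'] P ag_alt_product[OF q, of 2] by (simp add: D2_def R2_def P_def field_simps)
  show "ag_sum q 0 0 = qpoch_inf_list [q ^ 3, q ^ 4, q ^ 7] (q ^ 7) / qpoch_inf q q"
    using D(3)[OF lim'] P ag_alt_product[OF q, of 3] by (simp add: D3_def R3_def P_def field_simps)
qed

section \<open>From the triple sum to the double sum\<close>

lemma qpoch_inf_split:
  assumes q: "norm q < 1" and a: "norm a < 1"
  shows "qpoch_inf a q = qpoch a q n * qpoch_inf (a * q ^ n) q"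
proof -
  have "norm (a * q ^ n) \<le> norm a * 1"
    unfolding norm_mult norm_power using q by (intro mult_left_mono power_le_one) auto
  then have "qpoch_inf (a * q ^ n) q \<noteq> 0"
    using a by (intro qpoch_inf_nonzero q) simp
  from qpoch_eq_quotient[OF q this] this show ?thesis by simp
qed

lemma qpoch_square: "qpoch q q n * qpoch (- q) q n = qpoch (q\<^sup>2) (q\<^sup>2) n"
  unfolding qpoch_def prod.distrib[symmetric]
  by (intro prod.cong refl) (simp add: algebra_simps power2_eq_square power_mult_distrib)

lemma qpoch_inf_square:
  assumes q: "norm q < 1"
  shows "qpoch_inf q q * qpoch_inf (- q) q = qpoch_inf (q\<^sup>2) (q\<^sup>2)"
proof -
  have "norm (q\<^sup>2) < 1" using q by (simp add: norm_power power_less_one_iff)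
  from qpoch_tendsto[OF this]
  have "(\<lambda>n. qpoch q q n * qpoch (- q) q n) \<longlonglongrightarrow> qpoch_inf (q\<^sup>2) (q\<^sup>2)"
    by (simp only: qpoch_square)
  moreover have "(\<lambda>n. qpoch q q n * qpoch (- q) q n) \<longlonglongrightarrow> qpoch_inf q q * qpoch_inf (- q) q"
    by (intro tendsto_mult qpoch_tendsto q)
  ultimately show ?thesis using LIMSEQ_unique by blast
qed

text \<open>
  By Euler's series the sum over \<open>i\<close> is \<open>(-q^(j+1);q)_\<infinity> = (-q;q)_\<infinity> / (-q;q)_j\<close>, and \<open>(q;q)_j (-q;q)_j = (q^2;q^2)_j\<close>, so
  what remains is a double sum in the base \<open>q^2\<close>. Absolute summability of the triple sum justifies
  summing over \<open>i\<close> first.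
\<close>

lemma triple_sum_eq_ag_sum:
  assumes q: "norm q < 1"
  shows "((\<lambda>(i, j, k). q ^ ((Suc i choose 2) + i * j + 2 * (2 * j\<^sup>2 + 2 * j * k + k\<^sup>2 + \<alpha> * j + \<beta> * k))
      / (qpoch q q i * qpoch q q j * qpoch (q\<^sup>2) (q\<^sup>2) k))
    has_sum qpoch_inf (- q) q * ag_sum (q\<^sup>2) \<alpha> \<beta>) (UNIV :: (nat \<times> nat \<times> nat) set)"
proof -
  define p where "p = q\<^sup>2"
  have p: "norm p < 1" using q by (simp add: p_def norm_power power_less_one_iff)
  define E where "E = (\<lambda>j k :: nat. 2 * j\<^sup>2 + 2 * j * k + k\<^sup>2 + \<alpha> * j + \<beta> * k)"
  define F where "F = (\<lambda>((j, k), i). q ^ ((Suc i choose 2) + i * j + 2 * E j k)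
      / (qpoch q q i * qpoch q q j * qpoch p p k))"
  obtain A where A: "A \<ge> 1" "\<And>n. norm (qpoch q q n) \<le> A" "\<And>n. norm (inverse (qpoch q q n)) \<le> A"
    using qpoch_self_bounds[OF q] by blast
  obtain B where B: "B \<ge> 1" "\<And>n. norm (qpoch p p n) \<le> B" "\<And>n. norm (inverse (qpoch p p n)) \<le> B"
    using qpoch_self_bounds[OF p] by blast
  have "(\<lambda>x. norm (F x)) summable_on ((UNIV :: (nat \<times> nat) set) \<times> (UNIV :: nat set))"
  proof (rule Infinite_Sum.abs_summable_on_comparison_test')
    define r where "r = norm q"
    have r: "0 \<le> r" "r < 1" using q by (auto simp: r_def)
    let ?g = "\<lambda>(j, k). r ^ j * r ^ k"
    have geo: "((\<lambda>i. r ^ i) has_sum (1 / (1 - r))) UNIV"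
      using r geometric_sums[of r] summable_geometric[of r]
      by (intro norm_summable_imp_has_sum) (auto simp: norm_power)
    have "(\<lambda>(x, i). ?g x * r ^ i) summable_on ((UNIV :: (nat \<times> nat) set) \<times> (UNIV :: nat set))"
    proof (rule summable_on_SigmaI)
      show "((\<lambda>i. case (x, i) of (x, i) \<Rightarrow> ?g x * r ^ i) has_sum (?g x * (1 / (1 - r)))) UNIV" for x :: "nat \<times> nat"
        using has_sum_cmult_right[OF geo, of "?g x"] by simp
      show "(\<lambda>x. ?g x * (1 / (1 - r))) summable_on (UNIV :: (nat \<times> nat) set)"
        using has_sum_imp_summable[OF two_geometric_has_sum[OF r]] by (rule summable_on_cmult_left)
    qed (use r in \<open>auto simp: split_def\<close>)
    then show "(\<lambda>y. A * A * B * (case y of (x, i) \<Rightarrow> ?g x * r ^ i))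
        summable_on ((UNIV :: (nat \<times> nat) set) \<times> (UNIV :: nat set))"
      by (rule summable_on_cmult_right)
    fix y :: "(nat \<times> nat) \<times> nat"
    obtain j k i where y: "y = ((j, k), i)" by (metis prod.exhaust)
    have "j \<le> j\<^sup>2" "k \<le> k\<^sup>2" by (auto simp: power2_eq_square)
    then have "j + k + i \<le> (Suc i choose 2) + i * j + 2 * E j k"
      by (simp add: E_def Suc_choose_two)
    then have 1: "r ^ ((Suc i choose 2) + i * j + 2 * E j k) \<le> r ^ (j + k + i)"
      using r by (intro power_decreasing) auto
    have "norm (F y) = norm (inverse (qpoch q q i)) * norm (inverse (qpoch q q j)) * norm (inverse (qpoch p p k))
        * r ^ ((Suc i choose 2) + i * j + 2 * E j k)"
      by (simp add: F_def y r_def norm_mult norm_divide norm_inverse norm_power field_simps)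
    also have "\<dots> \<le> A * A * B * r ^ (j + k + i)"
      using A B r by (intro mult_mono 1) auto
    finally show "norm (F y) \<le> A * A * B * (case y of (x, i) \<Rightarrow> ?g x * r ^ i)"
      by (simp add: y power_add mult.assoc)
  qed
  then have summable: "F summable_on ((UNIV :: (nat \<times> nat) set) \<times> (UNIV :: nat set))"
    by (rule abs_summable_summable)
  have inner: "((\<lambda>i. F (x, i)) has_sum (qpoch_inf (- q) q * ag_term p \<alpha> \<beta> x)) UNIV" for x
  proof (cases x)
    case (Pair j k)
    define c where "c = p ^ E j k / (qpoch q q j * qpoch p p k)"
    have "norm (q ^ Suc j) < 1" unfolding norm_power using q by (simp add: power_less_one_iff del: power_Suc)
    from has_sum_cmult_right[OF euler_sum[OF q this], of c]
    have "((\<lambda>i. c * (q ^ (i choose 2) * (q ^ Suc j) ^ i / qpoch q q i)) has_sum c * qpoch_inf (- (q ^ Suc j)) q) UNIV" .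
    moreover have "c * (q ^ (i choose 2) * (q ^ Suc j) ^ i / qpoch q q i) = F (x, i)" for i
    proof -
      have "(Suc i choose 2) + i * j = (i choose 2) + Suc j * i" by (simp add: Suc_choose_two)
      then have "q ^ ((Suc i choose 2) + i * j + 2 * E j k) = q ^ (i choose 2) * (q ^ Suc j) ^ i * p ^ E j k"
        unfolding p_def by (simp only: power_add power_mult)
      then show ?thesis by (simp add: F_def Pair c_def mult_ac)
    qed
    moreover have "c * qpoch_inf (- (q ^ Suc j)) q = qpoch_inf (- q) q * ag_term p \<alpha> \<beta> x"
    proof -
      have "qpoch_inf (- q) q = qpoch (- q) q j * qpoch_inf (- (q ^ Suc j)) q"
        using qpoch_inf_split[OF q, of "- q" j] q by simp
      moreover have "qpoch (- q) q j \<noteq> 0" by (rule qpoch_nonzero) (use q in auto)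
      moreover have "ag_term p \<alpha> \<beta> x = p ^ E j k / (qpoch q q j * qpoch (- q) q j * qpoch p p k)"
        by (simp add: Pair ag_term_def E_def p_def qpoch_square)
      ultimately show ?thesis by (simp add: c_def field_simps)
    qed
    ultimately show ?thesis by simp
  qed
  have outer: "((\<lambda>x. qpoch_inf (- q) q * ag_term p \<alpha> \<beta> x) has_sum qpoch_inf (- q) q * ag_sum p \<alpha> \<beta>) UNIV"
    by (rule has_sum_cmult_right[OF ag_term_has_sum[OF p]])
  have "(F has_sum qpoch_inf (- q) q * ag_sum p \<alpha> \<beta>) (UNIV \<times> UNIV)"
    by (rule has_sum_SigmaI[OF inner outer summable])
  then have "((\<lambda>(i, x). F (x, i)) has_sum qpoch_inf (- q) q * ag_sum p \<alpha> \<beta>) (UNIV \<times> UNIV)"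
    by (simp only: has_sum_swap[of F])
  then show ?thesis by (simp add: F_def E_def p_def split_def)
qed

theorem theorem3p13:
  fixes q :: complex
  assumes "norm q < 1"
  shows "((\<lambda>(i, j, k).
             q ^ ((i\<^sup>2 + i) div 2 + 4 * j\<^sup>2 + 2 * k\<^sup>2 + i * j + 4 * j * k)
               / (qpoch q q i * qpoch q q j * qpoch (q\<^sup>2) (q\<^sup>2) k))
           has_sum (qpoch_inf_list [q ^ 6, q ^ 8, q ^ 14] (q ^ 14) / qpoch_inf q q))
           (UNIV :: (nat \<times> nat \<times> nat) set)
    \<and> ((\<lambda>(i, j, k).
             q ^ ((i\<^sup>2 + i) div 2 + 4 * j\<^sup>2 + 2 * k\<^sup>2 + i * j + 4 * j * k + 2 * j)
               / (qpoch q q i * qpoch q q j * qpoch (q\<^sup>2) (q\<^sup>2) k))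
           has_sum (qpoch_inf_list [q ^ 4, q ^ 10, q ^ 14] (q ^ 14) / qpoch_inf q q))
           (UNIV :: (nat \<times> nat \<times> nat) set)
    \<and> ((\<lambda>(i, j, k).
             q ^ ((i\<^sup>2 + i) div 2 + 4 * j\<^sup>2 + 2 * k\<^sup>2 + i * j + 4 * j * k + 4 * j + 2 * k)
               / (qpoch q q i * qpoch q q j * qpoch (q\<^sup>2) (q\<^sup>2) k))
           has_sum (qpoch_inf_list [q ^ 2, q ^ 12, q ^ 14] (q ^ 14) / qpoch_inf q q))
           (UNIV :: (nat \<times> nat \<times> nat) set)"
proof -
  have q2: "norm (q\<^sup>2) < 1" using assms by (simp add: norm_power power_less_one_iff)
  have tri: "(i\<^sup>2 + i) div 2 = (Suc i choose 2)" for i :: nat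
    by (simp add: choose_two power2_eq_square mult.commute)
  have cancel: "qpoch_inf (- q) q * (x / qpoch_inf (q\<^sup>2) (q\<^sup>2)) = x / qpoch_inf q q" for x
  proof -
    have "qpoch_inf (- q) q \<noteq> 0" by (rule qpoch_inf_nonzero) (use assms in auto)
    then show ?thesis by (simp flip: qpoch_inf_square[OF assms])
  qed
  note ag = andrews_gordon_mod_7[OF q2, folded power_mult]
  have "i + 4 * j\<^sup>2 + 2 * k\<^sup>2 + l + 4 * j * k = i + l + 2 * (2 * j\<^sup>2 + 2 * j * k + k\<^sup>2 + 0 * j + 0 * k)"
    "i + 4 * j\<^sup>2 + 2 * k\<^sup>2 + l + 4 * j * k + 2 * j = i + l + 2 * (2 * j\<^sup>2 + 2 * j * k + k\<^sup>2 + 1 * j + 0 * k)"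
    "i + 4 * j\<^sup>2 + 2 * k\<^sup>2 + l + 4 * j * k + 4 * j + 2 * k = i + l + 2 * (2 * j\<^sup>2 + 2 * j * k + k\<^sup>2 + 2 * j + 1 * k)"
    for i j k l :: nat by simp_all
  note exponents = this
  show ?thesis
    unfolding tri
    using triple_sum_eq_ag_sum[OF assms, of 0 0] triple_sum_eq_ag_sum[OF assms, of 1 0]
      triple_sum_eq_ag_sum[OF assms, of 2 1]
    unfolding exponents[symmetric] ag cancel by simp
qed

end
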